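(* Let $U\subset\mathbb{R}^2$ be open and let $f,n:U\to\mathbb{R}$ be smooth functions such that $V(u,v)=(-v,u,n(u,v))$ is a velocity diagram of an infinitesimal isometry of the surface $F(u,v)=(u,v,f(u,v))$, i.e. $f_{uu}n_{vv}-2f_{uv}n_{uv}+f_{vv}n_{uu}=0$ on $U$. Assume $n_{uu}n_{vv}-n_{uv}^2\neq 0$ on $U$. Let $c:U\to\mathbb{R}$ satisfy $c_u=f_un_{uv}-f_vn_{uu}$ and $c_v=f_un_{vv}-f_vn_{uv}$, and let $$C=(-n_u,-n_v,c),\qquad \bar C=(-n_v,\,n_u,\,-n+n_uu+n_vv)$$ be the rotation diagram and the translation diagram of $(F,V)$. Then the four surfaces have the contact element representations $$F=(u,v,f,f_u,f_v),\quad V=(-v,u,n,-n_v,n_u),$$ $$C=(-n_u,-n_v,c,f_v,-f_u),\quad \bar C=(-n_v,n_u,-n+n_uu+n_vv,-v,u),$$ and moreover: (i) $F$ and $V$ are I-orthogonally related, and $C$ and $\bar C$ are I-orthogonally related. (ii) $V$ and $\bar C$ correspond in the metric duality $\delta$. (iii) The tangent planes at corresponding points of $F$ and $JC$ are parallel to each other. (iv) The surface $\bar C$ is a velocity diagram of an infinitesimal isometry of the surface $C$, and $C$ is a velocity diagram of an infinitesimal isometry of $\bar C$.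
   Context: The top view of a point $(x,y,z)\in\mathbb{R}^3$ is $(x,y)$; the top view of a parametrized surface $X$ is denoted $\tilde X$. A plane is isotropic if it is parallel to the $z$-axis. An admissible surface is a regular parametrized surface without isotropic tangent planes (equivalently, its top view is an immersion into $\mathbb{R}^2$). Locally such a surface is a graph $z=\varphi(x,y)$, and its isotropic Gaussian curvature is $K=\varphi_{xx}\varphi_{yy}-\varphi_{xy}^2$. Points of different surfaces with the same parameter $(u,v)$ correspond. Velocity diagram: for an admissible surface $X(u,v)$ and a smooth map $Y(u,v)$ into $\mathbb{R}^3$, $Y$ is a velocity diagram of an infinitesimal isometry of $X$ (and $X$ is then infinitesimally flexible) if for $X^t=X+tY$ the $t$-derivatives at $t=0$ of $\langle\tilde X^t_u,\tilde X^t_u\rangle$, $\langle\tilde X^t_u,\tilde X^t_v\rangle$, $\langle\tilde X^t_v,\tilde X^t_v\rangle$ and of $K(X^t)$ all vanish at every point. Two surfaces $X,Y$ are I-orthogonally related if their top views satisfy $\langle\tilde X_u,\tilde Y_u\rangle=\langle\tilde X_v,\tilde Y_v\rangle=\langle\tilde X_u,\tilde Y_v\rangle+\langle\tilde X_v,\tilde Y_u\rangle=0$. The contact element $(x,y,z,p,q)$ is the point $(x,y,z)$ together with the plane through it with Euclidean normal vector $(p,q,-1)$; a contact element representation of a surface lists at each parameter the point and the tangent plane there. The metric duality $\delta$ maps a point $(a,b,w)$ to the plane $ax+by-z-w=0$ and vice versa; on contact elements $\delta(x,y,z,p,q)=(p,q,px+qy-z,x,y)$. Two surfaces correspond in $\delta$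 if $\delta$ maps the contact elements of one to the contact elements of the other at the same parameter. $J$ is the rotation $J(x,y,z)=(-y,x,z)$ about the $z$-axis by $\pi/2$. *)

theory Defs
  imports "HOL-Analysis.Analysis"
begin

type_synonym point3 = "real \<times> real \<times> real"

type_synonym surface = "real \<times> real \<Rightarrow> point3"

type_synonym contact_element = "real \<times> real \<times> real \<times> real \<times> real"

text \<open>\<open>C_k_on k g S\<close> is the usual class \<open>C^k\<close> when \<open>S\<close> is open and the domain of \<open>g\<close> has finite
  dimension: all iterated directional derivatives up to order \<open>k\<close> exist and are continuous.\<close>

primrec C_k_on ::
  "nat \<Rightarrow> ('a::real_normed_vector \<Rightarrow> 'b::real_normed_vector) \<Rightarrow> 'a set \<Rightarrow> bool" where
  "C_k_on 0 g S \<longleftrightarrow> continuous_on S g"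
| "C_k_on (Suc k) g S \<longleftrightarrow>
     (\<forall>x\<in>S. g differentiable (at x)) \<and>
     (\<forall>d. C_k_on k (\<lambda>x. frechet_derivative g (at x) d) S)"

definition smooth_on :: "'a::real_normed_vector set \<Rightarrow> ('a \<Rightarrow> 'b::real_normed_vector) \<Rightarrow> bool" where
  "smooth_on S g \<longleftrightarrow> (\<forall>k. C_k_on k g S)"

definition partial_u ::
  "(real \<times> real \<Rightarrow> 'a::real_normed_vector) \<Rightarrow> real \<times> real \<Rightarrow> 'a" ("\<partial>\<^sub>u") where
  "\<partial>\<^sub>u g p = vector_derivative (\<lambda>s. g (s, snd p)) (at (fst p))"

definition partial_v ::
  "(real \<times> real \<Rightarrow> 'a::real_normed_vector) \<Rightarrow> real \<times> real \<Rightarrow> 'a" ("\<partial>\<^sub>v") where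
  "\<partial>\<^sub>v g p = vector_derivative (\<lambda>s. g (fst p, s)) (at (snd p))"

definition regular_surface :: "(real \<times> real) set \<Rightarrow> surface \<Rightarrow> bool" where
  "regular_surface U X \<longleftrightarrow>
     open U \<and> smooth_on U X \<and> (\<forall>p\<in>U. dim {\<partial>\<^sub>u X p, \<partial>\<^sub>v X p} = 2)"

definition tangent_plane :: "surface \<Rightarrow> real \<times> real \<Rightarrow> point3 set" where
  "tangent_plane X p = {X p + a *\<^sub>R \<partial>\<^sub>u X p + b *\<^sub>R \<partial>\<^sub>v X p | a b. True}"

definition isotropic :: "point3 set \<Rightarrow> bool" where
  "isotropic P \<longleftrightarrow> (\<forall>x\<in>P. \<forall>s. x + (0, 0, s) \<in> P)"

definition admissible_surface :: "(real \<times> real) set \<Rightarrow> surface \<Rightarrow> bool" where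
  "admissible_surface U X \<longleftrightarrow>
     regular_surface U X \<and> (\<forall>p\<in>U. \<not> isotropic (tangent_plane X p))"

fun top_view :: "point3 \<Rightarrow> real \<times> real" where
  "top_view (x, y, z) = (x, y)"

text \<open>\<open>k\<close> is the value at \<open>X p\<close> obtained from a local representation of \<open>X\<close> as a graph
  \<open>z = \<phi>(x, y)\<close>. The partial derivatives of \<open>\<phi>\<close> are those with respect to its own arguments
  \<open>(x, y)\<close>, not to the surface parameters.\<close>

definition has_iso_curvature :: "surface \<Rightarrow> real \<times> real \<Rightarrow> real \<Rightarrow> bool" where
  "has_iso_curvature X p k \<longleftrightarrow>
     (\<exists>W N \<phi>. open W \<and> p \<in> W \<and> open N \<and> smooth_on N \<phi> \<and>
        X ` W = (\<lambda>(x, y). (x, y, \<phi> (x, y))) ` N \<and>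
        (let q = top_view (X p)
         in k = \<partial>\<^sub>u (\<partial>\<^sub>u \<phi>) q * \<partial>\<^sub>v (\<partial>\<^sub>v \<phi>) q - (\<partial>\<^sub>v (\<partial>\<^sub>u \<phi>) q)\<^sup>2))"

text \<open>This is meaningful at points where the top view of \<open>X\<close> is a local diffeomorphism; there the
  germ of \<open>\<phi>\<close>, and hence \<open>k\<close>, is unique.\<close>

definition iso_curvature :: "surface \<Rightarrow> real \<times> real \<Rightarrow> real" where
  "iso_curvature X p = (THE k. has_iso_curvature X p k)"

definition deformation :: "surface \<Rightarrow> surface \<Rightarrow> real \<Rightarrow> surface" where
  "deformation X Y t = (\<lambda>p. X p + t *\<^sub>R Y p)"

definition top_u :: "surface \<Rightarrow> real \<times> real \<Rightarrow> real \<times> real" where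
  "top_u X = \<partial>\<^sub>u (top_view \<circ> X)"

definition top_v :: "surface \<Rightarrow> real \<times> real \<Rightarrow> real \<times> real" where
  "top_v X = \<partial>\<^sub>v (top_view \<circ> X)"

text \<open>For \<open>t\<close> near \<open>0\<close> (depending on \<open>p\<close>) the deformed surface still has a non-isotropic tangent
  plane at \<open>p\<close>, so its curvature there is meaningful.\<close>

definition velocity_diagram :: "(real \<times> real) set \<Rightarrow> surface \<Rightarrow> surface \<Rightarrow> bool" where
  "velocity_diagram U X Y \<longleftrightarrow>
     admissible_surface U X \<and> smooth_on U Y \<and>
     (\<forall>p\<in>U.
        ((\<lambda>t. top_u (deformation X Y t) p \<bullet> top_u (deformation X Y t) p)
           has_real_derivative 0) (at 0) \<and>
        ((\<lambda>t. top_u (deformation X Y t) p \<bullet> top_v (deformation X Y t) p)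
           has_real_derivative 0) (at 0) \<and>
        ((\<lambda>t. top_v (deformation X Y t) p \<bullet> top_v (deformation X Y t) p)
           has_real_derivative 0) (at 0) \<and>
        ((\<lambda>t. iso_curvature (deformation X Y t) p) has_real_derivative 0) (at 0))"

definition I_orthogonal :: "(real \<times> real) set \<Rightarrow> surface \<Rightarrow> surface \<Rightarrow> bool" where
  "I_orthogonal U X Y \<longleftrightarrow>
     regular_surface U X \<and> regular_surface U Y \<and>
     (\<forall>p\<in>U. top_u X p \<bullet> top_u Y p = 0 \<and> top_v X p \<bullet> top_v Y p = 0 \<and>
        top_u X p \<bullet> top_v Y p + top_v X p \<bullet> top_u Y p = 0)"

fun contact_point :: "contact_element \<Rightarrow> point3" where
  "contact_point (x, y, z, p, q) = (x, y, z)"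

fun contact_plane :: "contact_element \<Rightarrow> point3 set" where
  "contact_plane (x, y, z, p, q) = {P. (P - (x, y, z)) \<bullet> (p, q, -1) = 0}"

definition contact_representation ::
  "(real \<times> real) set \<Rightarrow> surface \<Rightarrow> (real \<times> real \<Rightarrow> contact_element) \<Rightarrow> bool" where
  "contact_representation U X E \<longleftrightarrow>
     regular_surface U X \<and>
     (\<forall>p\<in>U. X p = contact_point (E p) \<and> tangent_plane X p = contact_plane (E p))"

fun metric_duality :: "contact_element \<Rightarrow> contact_element" where
  "metric_duality (x, y, z, p, q) = (p, q, p * x + q * y - z, x, y)"

fun dual_plane :: "point3 \<Rightarrow> point3 set" where
  "dual_plane (a, b, w) = {(x, y, z). a * x + b * y - z - w = 0}"

text \<open>On contact elements, the duality exchanges point and plane as prescribed by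
  \<open>dual_plane\<close>.\<close>

lemma metric_duality_contact:
  "contact_plane (metric_duality e) = dual_plane (contact_point e)"
  "dual_plane (contact_point (metric_duality e)) = contact_plane e"
  by (cases e; auto simp: inner_prod_def algebra_simps)+

definition correspond_in_duality ::
  "(real \<times> real) set \<Rightarrow> surface \<Rightarrow> surface \<Rightarrow> bool" where
  "correspond_in_duality U X Y \<longleftrightarrow>
     (\<exists>E E'. contact_representation U X E \<and> contact_representation U Y E' \<and>
        (\<forall>p\<in>U. metric_duality (E p) = E' p))"

fun rotate_J :: "point3 \<Rightarrow> point3" where
  "rotate_J (x, y, z) = (- y, x, z)"

definition graph_surface :: "(real \<times> real \<Rightarrow> real) \<Rightarrow> surface" where
  "graph_surface f = (\<lambda>(u, v). (u, v, f (u, v)))"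

definition rotation_field :: "(real \<times> real \<Rightarrow> real) \<Rightarrow> surface" where
  "rotation_field n = (\<lambda>(u, v). (- v, u, n (u, v)))"

definition rotation_diagram :: "(real \<times> real \<Rightarrow> real) \<Rightarrow> (real \<times> real \<Rightarrow> real) \<Rightarrow> surface" where
  "rotation_diagram n c = (\<lambda>(u, v). (- \<partial>\<^sub>u n (u, v), - \<partial>\<^sub>v n (u, v), c (u, v)))"

definition translation_diagram :: "(real \<times> real \<Rightarrow> real) \<Rightarrow> surface" where
  "translation_diagram n =
     (\<lambda>(u, v). (- \<partial>\<^sub>v n (u, v), \<partial>\<^sub>u n (u, v),
        - n (u, v) + \<partial>\<^sub>u n (u, v) * u + \<partial>\<^sub>v n (u, v) * v))"

end

theory Submission
  imports Defs
begin

text \<open>The four surfaces are treated as families of contact elements \<open>(x, y, z, p, q)\<close>, that is, points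
  \<open>(x, y, z)\<close> with \<open>dz = p dx + q dy\<close>. In this form the isotropic curvature is
  \<open>K = \<partial>(p, q) / \<partial>(x, y)\<close>, a quotient of Jacobian determinants in the surface parameters
  (\<open>iso_curvature_contact_chart\<close>).

  All infinitesimal isometries in question have a velocity diagram \<open>Y\<close> whose top view is that of
  \<open>X\<close> turned by a right angle, in the sense given by \<open>e = \<plusminus>1\<close>. This makes \<open>X\<close> and \<open>Y\<close>
  I-orthogonally related, and it makes the top view of \<open>X + t Y\<close> a similar image of that of \<open>X\<close> with
  squared scaling factor \<open>1 + t\<^sup>2\<close>. Hence the first-order conditions on the top view hold by themselves.
  If \<open>(p, q)\<close> and \<open>(r, s)\<close> are the gradients of \<open>X\<close> and \<open>Y\<close>, the curvature of \<open>X + t Y\<close> is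
  \<open>\<partial>(p + t e s, q - t e r) / \<partial>(x, y)\<close> divided by \<open>(1 + t\<^sup>2)\<^sup>2\<close>. So \<open>Y\<close> is a velocity diagram of \<open>X\<close> if
  and only if \<open>\<partial>(p, r) + \<partial>(q, s) = 0\<close> (\<open>velocity_diagram_iff\<close>).

  For \<open>(F, V)\<close> this condition is the equation between the second derivatives of \<open>f\<close> and \<open>n\<close>. For
  \<open>C\<close> and the translation diagram, in either order, it reduces to \<open>f\<^sub>u\<^sub>v = f\<^sub>v\<^sub>u\<close>. The remaining
  assertions are read off from the contact elements: the condition on \<open>n\<close> makes the top views of \<open>C\<close>
  and of the translation diagram immersions, the duality exchanges the contact elements of \<open>V\<close>
  with those of the translation diagram, and \<open>J C\<close> has the same gradient as \<open>F\<close>.\<close>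

section \<open>Smooth functions\<close>

lemma C_k_on_cong:
  assumes "open S" "\<And>x. x \<in> S \<Longrightarrow> f x = g x" "C_k_on k f S"
  shows "C_k_on k g S"
  using assms(2,3)
proof (induction k arbitrary: f g)
  case 0
  then show ?case using continuous_on_cong by force
next
  case (Suc k)
  have D: "(g has_derivative frechet_derivative f (at x)) (at x)" if "x \<in> S" for x
  proof (rule has_derivative_transform_within_open[OF _ \<open>open S\<close> that])
    show "(f has_derivative frechet_derivative f (at x)) (at x)"
      using Suc.prems that by (simp add: frechet_derivative_works)
  qed (use Suc.prems in auto)
  have "C_k_on k (\<lambda>x. frechet_derivative g (at x) d) S" for d
  proof (rule Suc.IH)
    show "C_k_on k (\<lambda>x. frechet_derivative f (at x) d) S" using Suc.prems by simp
  qed (metis D frechet_derivative_at)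
  then show ?case using D by (auto simp: differentiable_def)
qed

lemma smooth_on_cong:
  assumes "open S" "\<And>x. x \<in> S \<Longrightarrow> f x = g x" "smooth_on S f"
  shows "smooth_on S g"
  using assms C_k_on_cong unfolding smooth_on_def by blast

text \<open>Smoothness by coinduction: a class of functions that is stable under passing to directional
  derivatives consists of smooth functions. This turns every closure property below into a
  computation of a single first derivative.\<close>

lemma smooth_on_coinduct [consumes 2, case_names step]:
  fixes g :: "'a::real_normed_vector \<Rightarrow> 'b::real_normed_vector"
  assumes "open S" "P g"
    and step: "\<And>g. P g \<Longrightarrow>
      \<exists>D. (\<forall>x\<in>S. (g has_derivative D x) (at x)) \<and> (\<forall>d. P (\<lambda>x. D x d))"
  shows "smooth_on S g"
proof -
  have "C_k_on k g S" for k
    using \<open>P g\<close>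
  proof (induction k arbitrary: g)
    case 0
    then obtain D where "\<forall>x\<in>S. (g has_derivative D x) (at x)" using step by blast
    then show ?case
      by (auto intro!: continuous_at_imp_continuous_on dest: has_derivative_continuous)
  next
    case (Suc k)
    then obtain D where D: "\<And>x. x \<in> S \<Longrightarrow> (g has_derivative D x) (at x)"
      and P: "\<And>d. P (\<lambda>x. D x d)" using step by blast
    have "C_k_on k (\<lambda>x. frechet_derivative g (at x) d) S" for d
    proof (rule C_k_on_cong[OF \<open>open S\<close>])
      show "C_k_on k (\<lambda>x. D x d) S" by (rule Suc.IH[OF P])
    qed (metis D frechet_derivative_at)
    then show ?case using D by (auto simp: differentiable_def)
  qed
  then show ?thesis by (simp add: smooth_on_def)
qed

lemma smooth_on_has_frechet_derivative:
  "smooth_on S g \<Longrightarrow> x \<in> S \<Longrightarrow> (g has_derivative frechet_derivative g (at x)) (at x)"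
  by (metis C_k_on.simps(2) frechet_derivative_works smooth_on_def)

lemma smooth_on_frechet_derivative:
  "smooth_on S g \<Longrightarrow> smooth_on S (\<lambda>x. frechet_derivative g (at x) d)"
  by (metis C_k_on.simps(2) smooth_on_def)

lemma smooth_on_if_derivative_smooth:
  assumes "open S" "\<And>x. x \<in> S \<Longrightarrow> (g has_derivative D x) (at x)" "\<And>d. smooth_on S (\<lambda>x. D x d)"
  shows "smooth_on S g"
proof (rule smooth_on_coinduct[where P = "\<lambda>h. h = g \<or> smooth_on S h", OF \<open>open S\<close>])
  fix h :: "'a \<Rightarrow> 'b" assume "h = g \<or> smooth_on S h"
  then show "\<exists>D. (\<forall>x\<in>S. (h has_derivative D x) (at x)) \<and>
      (\<forall>d. (\<lambda>x. D x d) = g \<or> smooth_on S (\<lambda>x. D x d))"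
  proof
    assume "h = g"
    then show ?thesis using assms by (intro exI[of _ D]) auto
  next
    assume "smooth_on S h"
    then show ?thesis
      by (intro exI[of _ "\<lambda>x. frechet_derivative h (at x)"])
        (auto intro: smooth_on_has_frechet_derivative smooth_on_frechet_derivative)
  qed
qed simp

lemma smooth_on_const:
  assumes "open S" shows "smooth_on S (\<lambda>x. a)"
proof (rule smooth_on_coinduct[where P = "\<lambda>g. \<exists>a. g = (\<lambda>x. a)", OF assms])
  fix g :: "'a \<Rightarrow> 'b" assume "\<exists>a. g = (\<lambda>x. a)"
  then have "\<forall>x\<in>S. (g has_derivative (\<lambda>_. 0)) (at x)" by (elim exE) simp
  then show "\<exists>D. (\<forall>x\<in>S. (g has_derivative D x) (at x)) \<and> (\<forall>d. \<exists>a. (\<lambda>x. D x d) = (\<lambda>x. a))"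
    by (intro exI[of _ "\<lambda>_ _. 0"] conjI allI exI[of _ 0]) simp_all
qed blast

lemma smooth_on_bounded_linear:
  assumes "open S" "bounded_linear g" shows "smooth_on S g"
  by (rule smooth_on_if_derivative_smooth[where D = "\<lambda>_. g"])
    (use assms in \<open>auto intro: bounded_linear_imp_has_derivative smooth_on_const\<close>)

lemma smooth_on_Pair:
  assumes "open S" "smooth_on S f" "smooth_on S g"
  shows "smooth_on S (\<lambda>x. (f x, g x))"
proof (rule smooth_on_coinduct[where
      P = "\<lambda>h. \<exists>f g. h = (\<lambda>x. (f x, g x)) \<and> smooth_on S f \<and> smooth_on S g", OF \<open>open S\<close>])
  fix h :: "'a \<Rightarrow> 'b \<times> 'c"
  assume "\<exists>f g. h = (\<lambda>x. (f x, g x)) \<and> smooth_on S f \<and> smooth_on S g"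
  then obtain f g where h: "h = (\<lambda>x. (f x, g x))" and "smooth_on S f" "smooth_on S g"
    by blast
  then show "\<exists>D. (\<forall>x\<in>S. (h has_derivative D x) (at x)) \<and>
      (\<forall>d. \<exists>f g. (\<lambda>x. D x d) = (\<lambda>x. (f x, g x)) \<and> smooth_on S f \<and> smooth_on S g)"
    by (intro exI[of _ "\<lambda>x d. (frechet_derivative f (at x) d, frechet_derivative g (at x) d)"])
      (auto intro!: has_derivative_Pair smooth_on_has_frechet_derivative smooth_on_frechet_derivative)
qed (use assms in blast)

text \<open>Derivatives of a product or a quotient are again built from the factors and their derivatives.
  The class of such expressions is therefore stable under differentiation, which is what
  coinduction asks for.\<close>

inductive smooth_expression :: "'a::real_normed_vector set \<Rightarrow> ('a \<Rightarrow> real) \<Rightarrow> bool" for S where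
  base: "smooth_on S f \<Longrightarrow> smooth_expression S f"
| add: "smooth_expression S f \<Longrightarrow> smooth_expression S g \<Longrightarrow> smooth_expression S (\<lambda>x. f x + g x)"
| mult: "smooth_expression S f \<Longrightarrow> smooth_expression S g \<Longrightarrow> smooth_expression S (\<lambda>x. f x * g x)"
| inverse: "smooth_expression S f \<Longrightarrow> (\<forall>x\<in>S. f x \<noteq> 0) \<Longrightarrow> smooth_expression S (\<lambda>x. inverse (f x))"

lemma smooth_expression_derivative:
  assumes "open S" "smooth_expression S g"
  shows "\<exists>D. (\<forall>x\<in>S. (g has_derivative D x) (at x)) \<and> (\<forall>d. smooth_expression S (\<lambda>x. D x d))"
  using assms(2)
proof induction
  case (base f)
  then show ?case
    by (intro exI[of _ "\<lambda>x. frechet_derivative f (at x)"])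
      (auto intro: smooth_on_has_frechet_derivative smooth_on_frechet_derivative
        smooth_expression.base)
next
  case (add f g)
  then obtain D E where "\<forall>x\<in>S. (f has_derivative D x) (at x)" "\<forall>x\<in>S. (g has_derivative E x) (at x)"
    "\<And>d. smooth_expression S (\<lambda>x. D x d)" "\<And>d. smooth_expression S (\<lambda>x. E x d)" by blast
  then show ?case
    by (intro exI[of _ "\<lambda>x d. D x d + E x d"])
      (auto intro!: has_derivative_add smooth_expression.add)
next
  case (mult f g)
  then obtain D E where "\<forall>x\<in>S. (f has_derivative D x) (at x)" "\<forall>x\<in>S. (g has_derivative E x) (at x)"
    "\<And>d. smooth_expression S (\<lambda>x. D x d)" "\<And>d. smooth_expression S (\<lambda>x. E x d)" by blast
  then show ?case
    by (intro exI[of _ "\<lambda>x d. f x * E x d + D x d * g x"])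
      (auto intro!: has_derivative_mult smooth_expression.add smooth_expression.mult mult.hyps)
next
  case (inverse f)
  then obtain D where D: "\<forall>x\<in>S. (f has_derivative D x) (at x)"
    and "\<And>d. smooth_expression S (\<lambda>x. D x d)" by blast
  moreover have "smooth_expression S (\<lambda>x. -1)"
    by (rule smooth_expression.base[OF smooth_on_const[OF assms(1)]])
  ultimately have "smooth_expression S (\<lambda>x. -1 * (inverse (f x) * D x d * inverse (f x)))" for d
    using inverse.hyps by (intro smooth_expression.mult smooth_expression.inverse)
  moreover have "\<forall>x\<in>S. ((\<lambda>x. inverse (f x)) has_derivative
      (\<lambda>d. -1 * (inverse (f x) * D x d * inverse (f x)))) (at x)"
    using D inverse.hyps by (simp add: has_derivative_inverse)
  ultimately show ?case
    by (intro exI[of _ "\<lambda>x d. -1 * (inverse (f x) * D x d * inverse (f x))"] conjI allI)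
qed

lemma smooth_expression_imp_smooth_on:
  "open S \<Longrightarrow> smooth_expression S g \<Longrightarrow> smooth_on S g"
  by (rule smooth_on_coinduct[where P = "smooth_expression S"])
    (blast dest: smooth_expression_derivative)+

lemma smooth_on_add:
  fixes f g :: "'a::real_normed_vector \<Rightarrow> real"
  assumes "open S" "smooth_on S f" "smooth_on S g"
  shows "smooth_on S (\<lambda>x. f x + g x)"
  by (rule smooth_expression_imp_smooth_on[OF assms(1) smooth_expression.add[OF
        smooth_expression.base[OF assms(2)] smooth_expression.base[OF assms(3)]]])

lemma smooth_on_mult:
  fixes f g :: "'a::real_normed_vector \<Rightarrow> real"
  assumes "open S" "smooth_on S f" "smooth_on S g"
  shows "smooth_on S (\<lambda>x. f x * g x)"
  by (rule smooth_expression_imp_smooth_on[OF assms(1) smooth_expression.mult[OF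
        smooth_expression.base[OF assms(2)] smooth_expression.base[OF assms(3)]]])

lemma smooth_on_uminus:
  fixes f :: "'a::real_normed_vector \<Rightarrow> real"
  assumes "open S" "smooth_on S f"
  shows "smooth_on S (\<lambda>x. - f x)"
  using smooth_on_mult[OF assms(1) smooth_on_const[OF assms(1), of "-1"] assms(2)] by simp

lemma smooth_on_diff:
  fixes f g :: "'a::real_normed_vector \<Rightarrow> real"
  assumes "open S" "smooth_on S f" "smooth_on S g"
  shows "smooth_on S (\<lambda>x. f x - g x)"
  using smooth_on_add[OF assms(1,2) smooth_on_uminus[OF assms(1,3)]] by simp

lemma smooth_on_divide:
  fixes f g :: "'a::real_normed_vector \<Rightarrow> real"
  assumes "open S" "smooth_on S f" "smooth_on S g" "\<And>x. x \<in> S \<Longrightarrow> g x \<noteq> 0"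
  shows "smooth_on S (\<lambda>x. f x / g x)"
  unfolding divide_inverse
  by (rule smooth_expression_imp_smooth_on[OF assms(1) smooth_expression.mult[OF
        smooth_expression.base[OF assms(2)] smooth_expression.inverse[OF
          smooth_expression.base[OF assms(3)]]]]) (use assms(4) in blast)

lemmas smooth_on_intros = smooth_on_const smooth_on_Pair smooth_on_add smooth_on_mult
  smooth_on_uminus smooth_on_diff smooth_on_divide
  smooth_on_bounded_linear[OF _ bounded_linear_fst] smooth_on_bounded_linear[OF _ bounded_linear_snd]

lemma smooth_on_imp_continuous_on: "smooth_on S g \<Longrightarrow> continuous_on S g"
  by (metis C_k_on.simps(1) smooth_on_def)

lemma smooth_on_subset:
  assumes "smooth_on S g" "T \<subseteq> S" "open T" shows "smooth_on T g"
proof (rule smooth_on_coinduct[where P = "smooth_on S"])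
  fix h :: "'a \<Rightarrow> 'b" assume "smooth_on S h"
  then show "\<exists>D. (\<forall>x\<in>T. (h has_derivative D x) (at x)) \<and> (\<forall>d. smooth_on S (\<lambda>x. D x d))"
    using assms(2) by (intro exI[of _ "\<lambda>x. frechet_derivative h (at x)"])
      (auto intro: smooth_on_has_frechet_derivative smooth_on_frechet_derivative)
qed (use assms in auto)

section \<open>Partial derivatives\<close>

lemma has_vector_derivative_slices:
  assumes "(g has_derivative D) (at (a, b))"
  shows "((\<lambda>s. g (s, b)) has_vector_derivative D (1, 0)) (at a)"
    and "((\<lambda>s. g (a, s)) has_vector_derivative D (0, 1)) (at b)"
proof -
  have D: "bounded_linear D" using assms by (rule has_derivative_bounded_linear)
  have lin: "D (h, 0) = h *\<^sub>R D (1, 0)" "D (0, h) = h *\<^sub>R D (0, 1)" for h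
    unfolding linear_simps(5)[OF D, symmetric] by simp_all
  have "((\<lambda>s. g (s, b)) has_derivative (\<lambda>h. D (h, 0))) (at a)"
    by (rule has_derivative_compose[where f = "\<lambda>s. (s, b)" and g = g and g' = D])
      (use assms in \<open>auto intro!: derivative_eq_intros\<close>)
  then show "((\<lambda>s. g (s, b)) has_vector_derivative D (1, 0)) (at a)"
    by (simp only: has_vector_derivative_def lin[symmetric])
  have "((\<lambda>s. g (a, s)) has_derivative (\<lambda>h. D (0, h))) (at b)"
    by (rule has_derivative_compose[where f = "\<lambda>s. (a, s)" and g = g and g' = D])
      (use assms in \<open>auto intro!: derivative_eq_intros\<close>)
  then show "((\<lambda>s. g (a, s)) has_vector_derivative D (0, 1)) (at b)"
    by (simp only: has_vector_derivative_def lin[symmetric])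
qed

lemma partial_eqI:
  assumes "(g has_derivative D) (at p)"
  shows "\<partial>\<^sub>u g p = D (1, 0)" "\<partial>\<^sub>v g p = D (0, 1)"
  using has_vector_derivative_slices[of g D "fst p" "snd p"] assms
  by (simp_all add: partial_u_def partial_v_def vector_derivative_at)

lemma has_derivative_partials:
  assumes "smooth_on S g" "p \<in> S"
  shows "(g has_derivative (\<lambda>d. fst d *\<^sub>R \<partial>\<^sub>u g p + snd d *\<^sub>R \<partial>\<^sub>v g p)) (at p)"
proof -
  let ?D = "frechet_derivative g (at p)"
  have D: "(g has_derivative ?D) (at p)" using assms by (rule smooth_on_has_frechet_derivative)
  then have "bounded_linear ?D" by (rule has_derivative_bounded_linear)
  then have "?D (a *\<^sub>R (1, 0) + b *\<^sub>R (0, 1)) = a *\<^sub>R ?D (1, 0) + b *\<^sub>R ?D (0, 1)" for a b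
    by (simp only: linear_simps(1,5))
  from this[of "fst d" "snd d" for d]
  have "?D d = fst d *\<^sub>R \<partial>\<^sub>u g p + snd d *\<^sub>R \<partial>\<^sub>v g p" for d
    unfolding partial_eqI[OF D] by (metis add.left_neutral add.right_neutral add_Pair
        mult.right_neutral mult_zero_right prod.collapse real_scaleR_def scaleR_Pair)
  then have "?D = (\<lambda>d. fst d *\<^sub>R \<partial>\<^sub>u g p + snd d *\<^sub>R \<partial>\<^sub>v g p)" by (rule ext)
  with D show ?thesis by (rule subst[rotated])
qed

lemma smooth_on_partial:
  assumes "open S" "smooth_on S g"
  shows "smooth_on S (\<partial>\<^sub>u g)" "smooth_on S (\<partial>\<^sub>v g)"
proof -
  note D = smooth_on_has_frechet_derivative[OF assms(2)]
  show "smooth_on S (\<partial>\<^sub>u g)"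
    by (rule smooth_on_cong[OF assms(1) _ smooth_on_frechet_derivative[OF assms(2), of "(1, 0)"]])
      (simp add: partial_eqI[OF D])
  show "smooth_on S (\<partial>\<^sub>v g)"
    by (rule smooth_on_cong[OF assms(1) _ smooth_on_frechet_derivative[OF assms(2), of "(0, 1)"]])
      (simp add: partial_eqI[OF D])
qed

lemma partial_cong:
  assumes "open S" "p \<in> S" "\<And>w. w \<in> S \<Longrightarrow> f w = g w"
  shows "\<partial>\<^sub>u f p = \<partial>\<^sub>u g p" "\<partial>\<^sub>v f p = \<partial>\<^sub>v g p"
proof -
  obtain A B where AB: "open A" "open B" "p \<in> A \<times> B" "A \<times> B \<subseteq> S"
    using open_prod_elim[OF assms(1,2)] by metis
  then have "\<forall>\<^sub>F s in nhds (fst p). s \<in> A" "\<forall>\<^sub>F s in nhds (snd p). s \<in> B"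
    by (auto intro!: eventually_nhds_in_open)
  then have "\<forall>\<^sub>F s in nhds (fst p). f (s, snd p) = g (s, snd p)"
    "\<forall>\<^sub>F s in nhds (snd p). f (fst p, s) = g (fst p, s)"
    using AB by (auto elim!: eventually_mono intro!: assms(3))
  then show "\<partial>\<^sub>u f p = \<partial>\<^sub>u g p" "\<partial>\<^sub>v f p = \<partial>\<^sub>v g p"
    unfolding partial_u_def partial_v_def
    by (auto intro!: vector_derivative_cong_eq elim!: eventually_mono)
qed

lemma partial_slices:
  fixes g :: "real \<times> real \<Rightarrow> real"
  assumes "smooth_on S g" "(a, b) \<in> S"
  shows "((\<lambda>s. g (s, b)) has_real_derivative \<partial>\<^sub>u g (a, b)) (at a)"
    and "((\<lambda>s. g (a, s)) has_real_derivative \<partial>\<^sub>v g (a, b)) (at b)"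
  using has_vector_derivative_slices[OF smooth_on_has_frechet_derivative[OF assms]]
    partial_eqI[OF smooth_on_has_frechet_derivative[OF assms]]
  by (simp_all add: has_real_derivative_iff_has_vector_derivative)

text \<open>Applying the mean value theorem first to \<open>\<lambda>x. h x (b + r) - h x b\<close> and then to \<open>h'\<close> writes the
  second difference over a square as one value of the mixed derivative. The difference is symmetric
  in the two variables, so the same holds with the order of differentiation exchanged.\<close>

lemma mixed_difference_mean_value:
  fixes h h' h'' :: "real \<Rightarrow> real \<Rightarrow> real"
  assumes "0 < r"
    and h': "\<And>x y. x \<in> {a..a + r} \<Longrightarrow> y \<in> {b..b + r} \<Longrightarrow>
      ((\<lambda>x. h x y) has_real_derivative h' x y) (at x)"
    and h'': "\<And>x y. x \<in> {a..a + r} \<Longrightarrow> y \<in> {b..b + r} \<Longrightarrow>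
      ((\<lambda>y. h' x y) has_real_derivative h'' x y) (at y)"
  obtains x y where "x \<in> {a..a + r}" "y \<in> {b..b + r}"
    "h (a + r) (b + r) - h (a + r) b - h a (b + r) + h a b = r * r * h'' x y"
proof -
  have "\<exists>x>a. x < a + r \<and> (h (a + r) (b + r) - h (a + r) b) - (h a (b + r) - h a b)
      = (a + r - a) * (h' x (b + r) - h' x b)"
    by (rule MVT2) (use assms in \<open>auto intro!: derivative_intros h'\<close>)
  then obtain x where x: "a < x" "x < a + r"
    "(h (a + r) (b + r) - h (a + r) b) - (h a (b + r) - h a b) = r * (h' x (b + r) - h' x b)"
    by auto
  have "\<exists>y>b. y < b + r \<and> h' x (b + r) - h' x b = (b + r - b) * h'' x y"
    by (rule MVT2) (use x assms in \<open>auto intro!: h''\<close>)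
  then obtain y where "b < y" "y < b + r" "h' x (b + r) - h' x b = r * h'' x y" by auto
  with x show ?thesis by (intro that[of x y]) auto
qed

text \<open>Over small squares at \<open>w\<close>, the common second difference is \<open>r\<^sup>2\<close> times a value of either mixed
  derivative near \<open>w\<close>; by continuity the two agree at \<open>w\<close>.\<close>

lemma partials_commute:
  fixes h :: "real \<times> real \<Rightarrow> real"
  assumes "open U" "smooth_on U h" "w \<in> U"
  shows "\<partial>\<^sub>u (\<partial>\<^sub>v h) w = \<partial>\<^sub>v (\<partial>\<^sub>u h) w"
proof (rule ccontr)
  let ?A = "\<partial>\<^sub>u (\<partial>\<^sub>v h)" and ?B = "\<partial>\<^sub>v (\<partial>\<^sub>u h)"
  assume "?A w \<noteq> ?B w"
  define e where "e = dist (?A w) (?B w) / 2"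
  have "e > 0" using \<open>?A w \<noteq> ?B w\<close> by (simp add: e_def)
  have S: "smooth_on U ?A" "smooth_on U ?B" "smooth_on U (\<partial>\<^sub>u h)" "smooth_on U (\<partial>\<^sub>v h)"
    using assms by (auto intro!: smooth_on_partial)
  have "isCont ?A w" "isCont ?B w"
    using S(1,2)[THEN smooth_on_imp_continuous_on] assms continuous_on_eq_continuous_at by blast+
  obtain d1 where d1: "d1 > 0" "\<forall>w'. dist w' w < d1 \<longrightarrow> dist (?A w') (?A w) < e"
    using \<open>isCont ?A w\<close> \<open>e > 0\<close> unfolding continuous_at_eps_delta by blast
  obtain d2 where d2: "d2 > 0" "\<forall>w'. dist w' w < d2 \<longrightarrow> dist (?B w') (?B w) < e"
    using \<open>isCont ?B w\<close> \<open>e > 0\<close> unfolding continuous_at_eps_delta by blast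
  obtain d3 where d3: "d3 > 0" "ball w d3 \<subseteq> U" using assms open_contains_ball by blast
  obtain a b where w: "w = (a, b)" by (cases w)
  define r where "r = min d1 (min d2 d3) / 4"
  have "r > 0" using d1 d2 d3 by (simp add: r_def)
  have near: "dist (x, y) w < min d1 (min d2 d3)" if "x \<in> {a..a + r}" "y \<in> {b..b + r}" for x y
  proof -
    have "dist (x, y) w \<le> \<bar>x - a\<bar> + \<bar>y - b\<bar>"
      unfolding w dist_Pair_Pair by (rule order_trans[OF sqrt_sum_squares_le_sum_abs]) (auto simp: dist_real_def)
    also have "\<dots> \<le> r + r" using that by (intro add_mono) auto
    also have "\<dots> < min d1 (min d2 d3)" using \<open>r > 0\<close> unfolding r_def by linarith
    finally show ?thesis .
  qed
  have inU: "(x, y) \<in> U" if "x \<in> {a..a + r}" "y \<in> {b..b + r}" for x y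
    using near[OF that] d3 by (auto simp: dist_commute)
  obtain x y where 1: "x \<in> {a..a + r}" "y \<in> {b..b + r}"
    "h (a + r, b + r) - h (a + r, b) - h (a, b + r) + h (a, b) = r * r * ?B (x, y)"
    using mixed_difference_mean_value[OF \<open>r > 0\<close> partial_slices(1)[OF assms(2) inU]
        partial_slices(2)[OF S(3) inU], of a b] by blast
  obtain y' x' where 2: "y' \<in> {b..b + r}" "x' \<in> {a..a + r}"
    "h (a + r, b + r) - h (a, b + r) - h (a + r, b) + h (a, b) = r * r * ?A (x', y')"
    using mixed_difference_mean_value[OF \<open>r > 0\<close> partial_slices(2)[OF assms(2) inU]
        partial_slices(1)[OF S(4) inU], of b a] by blast
  have "r * r * ?A (x', y') = r * r * ?B (x, y)" using 1(3) 2(3) by linarith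
  then have "?A (x', y') = ?B (x, y)" using \<open>r > 0\<close> by simp
  moreover have "dist (?A (x', y')) (?A w) < e" "dist (?B (x, y)) (?B w) < e"
    using near[OF 1(1,2)] near[OF 2(2,1)] d1(2) d2(2) by auto
  ultimately show False
    using dist_triangle_half_r[of "?A (x', y')" "?A w" "2 * e" "?B w"] by (simp add: e_def)
qed

text \<open>For a function known only through its partial derivatives, such as the height \<open>c\<close> of the rotation
  diagram: continuous partial derivatives already give total differentiability, and the directional
  derivatives are then combinations of the smooth partial ones.\<close>

lemma smooth_on_if_partials_smooth:
  fixes g :: "real \<times> real \<Rightarrow> real"
  assumes "open U" "smooth_on U gu" "smooth_on U gv"
    and gu: "\<And>u v. (u, v) \<in> U \<Longrightarrow> ((\<lambda>s. g (s, v)) has_real_derivative gu (u, v)) (at u)"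
    and gv: "\<And>u v. (u, v) \<in> U \<Longrightarrow> ((\<lambda>s. g (u, s)) has_real_derivative gv (u, v)) (at v)"
  shows "smooth_on U g" "\<And>w. w \<in> U \<Longrightarrow> \<partial>\<^sub>u g w = gu w" "\<And>w. w \<in> U \<Longrightarrow> \<partial>\<^sub>v g w = gv w"
proof -
  have D: "(g has_derivative (\<lambda>d. gu w * fst d + gv w * snd d)) (at w)" if w: "w \<in> U" for w
  proof -
    obtain a b where ab: "w = (a, b)" by (cases w)
    obtain A B where AB: "open A" "open B" "(a, b) \<in> A \<times> B" "A \<times> B \<subseteq> U"
      using open_prod_elim[OF assms(1) w] unfolding ab by blast
    then obtain d where d: "d > 0" "ball b d \<subseteq> B" using openE[of B b] by blast
    have sub: "A \<times> ball b d \<subseteq> U" using AB d by auto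
    have scale: "blinfun_apply (k *\<^sub>R id_blinfun) = (*) k" for k :: real
      by (simp add: fun_eq_iff blinfun.scaleR_left)
    have "((\<lambda>(x, y). g (x, y)) has_derivative
        (\<lambda>(tx, ty). gu w * tx + blinfun_apply (gv (a, b) *\<^sub>R id_blinfun) ty))
        (at (a, b) within A \<times> ball b d)"
    proof (rule has_derivative_partialsI)
      show "((\<lambda>x. g (x, b)) has_derivative (\<lambda>tx. gu w * tx)) (at a within A)"
        using gu[of a b] w unfolding ab has_field_derivative_def
        by (blast intro: has_derivative_at_withinI)
      show "((\<lambda>y. g (x, y)) has_derivative blinfun_apply (gv (x, y) *\<^sub>R id_blinfun))
          (at y within ball b d)" if "x \<in> A" "y \<in> ball b d" for x y
        unfolding scale
        by (rule has_derivative_at_withinI[OF gv[unfolded has_field_derivative_def]])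
          (use that sub in blast)
      have "continuous (at (a, b) within A \<times> ball b d) gv"
        using continuous_on_subset[OF smooth_on_imp_continuous_on[OF assms(3)] sub] AB(3) d(1)
        by (simp add: continuous_on_eq_continuous_within)
      then show "continuous (at (a, b) within A \<times> ball b d) (\<lambda>(x, y). gv (x, y) *\<^sub>R id_blinfun)"
        unfolding case_prod_beta prod.collapse by (rule continuous_scaleR[OF _ continuous_const])
    qed (use d in auto)
    moreover have "at (a, b) within A \<times> ball b d = at w"
      unfolding ab using AB d by (intro at_within_open open_Times) auto
    ultimately show ?thesis by (simp add: scale case_prod_unfold ab)
  qed
  show "smooth_on U g"
  proof (rule smooth_on_if_derivative_smooth[OF assms(1) D])
    show "smooth_on U (\<lambda>w. gu w * fst d + gv w * snd d)" for d
      using assms(1-3) by (intro smooth_on_intros)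
  qed
  show "\<And>w. w \<in> U \<Longrightarrow> \<partial>\<^sub>u g w = gu w" "\<And>w. w \<in> U \<Longrightarrow> \<partial>\<^sub>v g w = gv w"
    using partial_eqI[OF D] by auto
qed

lemma partial_const [simp]: "\<partial>\<^sub>u (\<lambda>x. a) w = 0" "\<partial>\<^sub>v (\<lambda>x. a) w = 0"
  by (simp_all add: partial_u_def partial_v_def)

lemma partial_fst_snd [simp]:
  "\<partial>\<^sub>u (\<lambda>w :: real \<times> real. fst w) w = 1" "\<partial>\<^sub>v (\<lambda>w :: real \<times> real. fst w) w = 0"
  "\<partial>\<^sub>u (\<lambda>w :: real \<times> real. snd w) w = 0" "\<partial>\<^sub>v (\<lambda>w :: real \<times> real. snd w) w = 1"
  by (simp_all add: partial_u_def partial_v_def)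

lemma partial_Pair:
  assumes "smooth_on S f" "smooth_on S g" "w \<in> S"
  shows "\<partial>\<^sub>u (\<lambda>w. (f w, g w)) w = (\<partial>\<^sub>u f w, \<partial>\<^sub>u g w)" "\<partial>\<^sub>v (\<lambda>w. (f w, g w)) w = (\<partial>\<^sub>v f w, \<partial>\<^sub>v g w)"
  using partial_eqI[OF has_derivative_Pair[OF has_derivative_partials[OF assms(1,3)]
        has_derivative_partials[OF assms(2,3)]]] by simp_all

lemma partial_add:
  fixes f g :: "real \<times> real \<Rightarrow> real"
  assumes "smooth_on S f" "smooth_on S g" "w \<in> S"
  shows "\<partial>\<^sub>u (\<lambda>w. f w + g w) w = \<partial>\<^sub>u f w + \<partial>\<^sub>u g w" "\<partial>\<^sub>v (\<lambda>w. f w + g w) w = \<partial>\<^sub>v f w + \<partial>\<^sub>v g w"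
  using partial_eqI[OF has_derivative_add[OF has_derivative_partials[OF assms(1,3)]
        has_derivative_partials[OF assms(2,3)]]] by simp_all

lemma partial_mult:
  fixes f g :: "real \<times> real \<Rightarrow> real"
  assumes "smooth_on S f" "smooth_on S g" "w \<in> S"
  shows "\<partial>\<^sub>u (\<lambda>w. f w * g w) w = f w * \<partial>\<^sub>u g w + \<partial>\<^sub>u f w * g w"
    and "\<partial>\<^sub>v (\<lambda>w. f w * g w) w = f w * \<partial>\<^sub>v g w + \<partial>\<^sub>v f w * g w"
  using partial_eqI[OF has_derivative_mult[OF has_derivative_partials[OF assms(1,3)]
        has_derivative_partials[OF assms(2,3)]]] by simp_all

lemma partial_uminus:
  fixes f :: "real \<times> real \<Rightarrow> real"
  assumes "smooth_on S f" "w \<in> S"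
  shows "\<partial>\<^sub>u (\<lambda>w. - f w) w = - \<partial>\<^sub>u f w" "\<partial>\<^sub>v (\<lambda>w. - f w) w = - \<partial>\<^sub>v f w"
  using partial_eqI[OF has_derivative_minus[OF has_derivative_partials[OF assms]]] by simp_all

lemma partial_diff:
  fixes f g :: "real \<times> real \<Rightarrow> real"
  assumes "smooth_on S f" "smooth_on S g" "w \<in> S"
  shows "\<partial>\<^sub>u (\<lambda>w. f w - g w) w = \<partial>\<^sub>u f w - \<partial>\<^sub>u g w" "\<partial>\<^sub>v (\<lambda>w. f w - g w) w = \<partial>\<^sub>v f w - \<partial>\<^sub>v g w"
  using partial_eqI[OF has_derivative_diff[OF has_derivative_partials[OF assms(1,3)]
        has_derivative_partials[OF assms(2,3)]]] by simp_all

lemma partial_cmult: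
  fixes f :: "real \<times> real \<Rightarrow> real"
  assumes "smooth_on S f" "w \<in> S"
  shows "\<partial>\<^sub>u (\<lambda>w. a * f w) w = a * \<partial>\<^sub>u f w" "\<partial>\<^sub>v (\<lambda>w. a * f w) w = a * \<partial>\<^sub>v f w"
  using partial_eqI[OF has_derivative_mult_right[OF has_derivative_partials[OF assms]]]
  by simp_all

section \<open>Jacobian determinants and local inverses\<close>

definition jacobian_det :: "(real \<times> real \<Rightarrow> real) \<Rightarrow> (real \<times> real \<Rightarrow> real) \<Rightarrow> real \<times> real \<Rightarrow> real" where
  "jacobian_det a b w = \<partial>\<^sub>u a w * \<partial>\<^sub>v b w - \<partial>\<^sub>v a w * \<partial>\<^sub>u b w"

lemma smooth_on_jacobian_det:
  "open S \<Longrightarrow> smooth_on S a \<Longrightarrow> smooth_on S b \<Longrightarrow> smooth_on S (jacobian_det a b)"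
  unfolding jacobian_det_def[abs_def]
  by (intro smooth_on_diff smooth_on_mult smooth_on_partial)

text \<open>Cramer's rule for the matrix with rows \<open>(a, b)\<close> and \<open>(c, e)\<close>, in both directions.\<close>

lemma cramer:
  fixes a b c e s t :: real
  assumes "a * e - b * c \<noteq> 0"
  shows "(s * e - t * b) / (a * e - b * c) * a + (t * a - s * c) / (a * e - b * c) * b = s"
    and "(s * e - t * b) / (a * e - b * c) * c + (t * a - s * c) / (a * e - b * c) * e = t"
    and "((s * a + t * b) * e - (s * c + t * e) * b) / (a * e - b * c) = s"
    and "((s * c + t * e) * a - (s * a + t * b) * c) / (a * e - b * c) = t"
proof -
  define J where "J = a * e - b * c"
  have J: "J \<noteq> 0" using assms by (simp add: J_def)
  show "(s * e - t * b) / (a * e - b * c) * a + (t * a - s * c) / (a * e - b * c) * b = s"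
    "(s * e - t * b) / (a * e - b * c) * c + (t * a - s * c) / (a * e - b * c) * e = t"
    "((s * a + t * b) * e - (s * c + t * e) * b) / (a * e - b * c) = s"
    "((s * c + t * e) * a - (s * a + t * b) * c) / (a * e - b * c) = t"
    unfolding J_def[symmetric] using J
    by (simp_all add: times_divide_eq_left add_divide_distrib[symmetric] divide_eq_eq J_def del: times_divide_eq_right) algebra+
qed

text \<open>The inverse function theorem, with the derivative of the inverse written out by Cramer's rule
  so that it can be differentiated again.\<close>

lemma local_inverse:
  assumes "open U" "smooth_on U x" "smooth_on U y" "w0 \<in> U" "jacobian_det x y w0 \<noteq> 0"
  obtains W N g where "open W" "W \<subseteq> U" "w0 \<in> W" "open N" "homeomorphism W N (\<lambda>w. (x w, y w)) g"
    "\<And>w. w \<in> W \<Longrightarrow> jacobian_det x y w \<noteq> 0"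
    "\<And>k. k \<in> N \<Longrightarrow> (g has_derivative (\<lambda>d.
      ((fst d * \<partial>\<^sub>v y (g k) - snd d * \<partial>\<^sub>v x (g k)) / jacobian_det x y (g k),
       (snd d * \<partial>\<^sub>u x (g k) - fst d * \<partial>\<^sub>u y (g k)) / jacobian_det x y (g k)))) (at k)"
proof -
  define U' where "U' = {w \<in> U. jacobian_det x y w \<noteq> 0}"
  \<comment> \<open>\<open>L w\<close> is the derivative of the map at \<open>w\<close>, and \<open>M w\<close> the inverse matrix.\<close>
  define L where "L w d = (fst d * \<partial>\<^sub>u x w + snd d * \<partial>\<^sub>v x w, fst d * \<partial>\<^sub>u y w + snd d * \<partial>\<^sub>v y w)"
    for w d :: "real \<times> real"
  define M where "M w d = ((fst d * \<partial>\<^sub>v y w - snd d * \<partial>\<^sub>v x w) / jacobian_det x y w,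
     (snd d * \<partial>\<^sub>u x w - fst d * \<partial>\<^sub>u y w) / jacobian_det x y w)" for w d :: "real \<times> real"
  have "continuous_on U (jacobian_det x y)"
    by (intro smooth_on_imp_continuous_on smooth_on_jacobian_det assms)
  then have "open (U \<inter> jacobian_det x y -` (- {0}))"
    using assms(1) by (rule continuous_open_preimage) auto
  also have "U \<inter> jacobian_det x y -` (- {0}) = U'" by (auto simp: U'_def)
  finally have "open U'" .
  have "w0 \<in> U'" using assms by (simp add: U'_def)
  have blL: "bounded_linear (L w)" and blM: "bounded_linear (M w)" for w
    unfolding L_def[abs_def] M_def[abs_def] divide_inverse
    by (intro bounded_linear_Pair bounded_linear_add bounded_linear_sub bounded_linear_mult_const
        bounded_linear_fst bounded_linear_snd)+
  have LM: "L w (M w d) = d" "M w (L w d) = d" if "jacobian_det x y w \<noteq> 0" for w d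
    using cramer[OF that[unfolded jacobian_det_def]]
    by (simp_all only: L_def M_def jacobian_det_def fst_conv snd_conv prod.collapse)
  have L: "((\<lambda>w. (x w, y w)) has_derivative L w) (at w)" if "w \<in> U" for w
    unfolding L_def[abs_def] using has_derivative_Pair[OF has_derivative_partials[OF assms(2) that]
        has_derivative_partials[OF assms(3) that]] by simp
  obtain W N g g' where *: "open W" "W \<subseteq> U'" "w0 \<in> W" "open N" "homeomorphism W N (\<lambda>w. (x w, y w)) g"
    "\<And>k. k \<in> N \<Longrightarrow> (g has_derivative (g' k)) (at k)"
    "\<And>k. k \<in> N \<Longrightarrow> g' k = inv (blinfun_apply (Blinfun (L (g k))))"
  proof (rule inverse_function_theorem[of U' "\<lambda>w. (x w, y w)" "\<lambda>w. Blinfun (L w)" w0 "Blinfun (M w0)"])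
    show "((\<lambda>w. (x w, y w)) has_derivative blinfun_apply (Blinfun (L w))) (at w)" if "w \<in> U'" for w
      using L that by (simp add: bounded_linear_Blinfun_apply[OF blL] U'_def)
    have "continuous_on U (\<lambda>w. L w d)" for d
      unfolding L_def using assms
      by (intro continuous_intros smooth_on_imp_continuous_on smooth_on_partial)
    then have "continuous_on U' (\<lambda>w. L w d)" for d
      by (rule continuous_on_subset) (auto simp: U'_def)
    then show "continuous_on U' (\<lambda>w. Blinfun (L w))"
      by (intro continuous_on_blinfun_componentwise) (simp add: bounded_linear_Blinfun_apply[OF blL])
    show "Blinfun (M w0) o\<^sub>L Blinfun (L w0) = id_blinfun"
      using assms by (intro blinfun_eqI)
        (simp add: bounded_linear_Blinfun_apply[OF blL] bounded_linear_Blinfun_apply[OF blM] LM)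
  qed (use \<open>open U'\<close> \<open>w0 \<in> U'\<close> in blast)+
  have gW: "g k \<in> W" if "k \<in> N" for k
    using *(5) that by (auto simp: homeomorphism_def)
  show ?thesis
  proof (rule that[OF *(1) _ *(3,4,5)])
    show "W \<subseteq> U" "\<And>w. w \<in> W \<Longrightarrow> jacobian_det x y w \<noteq> 0" using *(2) by (auto simp: U'_def)
    fix k assume "k \<in> N"
    then have J: "jacobian_det x y (g k) \<noteq> 0" using gW[OF \<open>k \<in> N\<close>] *(2) by (auto simp: U'_def)
    have "inv (L (g k)) = M (g k)"
      by (rule inv_equality) (use LM[OF J] in auto)
    then have "(g has_derivative M (g k)) (at k)"
      using *(6,7)[OF \<open>k \<in> N\<close>] by (simp add: bounded_linear_Blinfun_apply[OF blL])
    then show "(g has_derivative (\<lambda>d.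
      ((fst d * \<partial>\<^sub>v y (g k) - snd d * \<partial>\<^sub>v x (g k)) / jacobian_det x y (g k),
       (snd d * \<partial>\<^sub>u x (g k) - fst d * \<partial>\<^sub>u y (g k)) / jacobian_det x y (g k)))) (at k)"
      by (simp only: M_def[abs_def])
  qed
qed

section \<open>Contact charts and isotropic curvature\<close>

text \<open>Surfaces are handled together with their contact elements \<open>(x, y, z, p, q)\<close>. The two equations
  say \<open>dz = p dx + q dy\<close>: wherever the surface is locally a graph over its top view, \<open>(p, q)\<close> is
  the gradient of the height function, as a function of the surface parameters. The determinant
  condition says that the top view is an immersion.\<close>

definition contact_chart :: "(real \<times> real) set \<Rightarrow> (real \<times> real \<Rightarrow> real) \<Rightarrow> (real \<times> real \<Rightarrow> real) \<Rightarrow>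
    (real \<times> real \<Rightarrow> real) \<Rightarrow> (real \<times> real \<Rightarrow> real) \<Rightarrow> (real \<times> real \<Rightarrow> real) \<Rightarrow> bool" where
  "contact_chart U x y z p q \<longleftrightarrow> open U \<and> smooth_on U x \<and> smooth_on U y \<and> smooth_on U z \<and>
     smooth_on U p \<and> smooth_on U q \<and>
     (\<forall>w\<in>U. jacobian_det x y w \<noteq> 0 \<and> \<partial>\<^sub>u z w = p w * \<partial>\<^sub>u x w + q w * \<partial>\<^sub>u y w \<and>
        \<partial>\<^sub>v z w = p w * \<partial>\<^sub>v x w + q w * \<partial>\<^sub>v y w)"

text \<open>The integrability condition of \<open>dz = p dx + q dy\<close>, that is \<open>dp \<and> dx + dq \<and> dy = 0\<close>. It expresses
  the symmetry of the Hessian of the height function in the surface parameters.\<close>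

lemma contact_chart_symmetry:
  assumes "contact_chart U x y z p q" "w \<in> U"
  shows "jacobian_det x p w = jacobian_det q y w"
proof -
  have U: "open U" and S: "smooth_on U x" "smooth_on U y" "smooth_on U z" "smooth_on U p" "smooth_on U q"
    and z: "\<And>w. w \<in> U \<Longrightarrow> \<partial>\<^sub>u z w = p w * \<partial>\<^sub>u x w + q w * \<partial>\<^sub>u y w"
      "\<And>w. w \<in> U \<Longrightarrow> \<partial>\<^sub>v z w = p w * \<partial>\<^sub>v x w + q w * \<partial>\<^sub>v y w"
    using assms by (auto simp: contact_chart_def)
  have "\<partial>\<^sub>v (\<partial>\<^sub>u z) w = p w * \<partial>\<^sub>v (\<partial>\<^sub>u x) w + \<partial>\<^sub>v p w * \<partial>\<^sub>u x w + (q w * \<partial>\<^sub>v (\<partial>\<^sub>u y) w + \<partial>\<^sub>v q w * \<partial>\<^sub>u y w)"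
    using S U assms(2) by (simp add: partial_cong(2)[OF U assms(2) z(1)] partial_add[of U]
        partial_mult[of U] smooth_on_mult smooth_on_partial)
  moreover have "\<partial>\<^sub>u (\<partial>\<^sub>v z) w = p w * \<partial>\<^sub>u (\<partial>\<^sub>v x) w + \<partial>\<^sub>u p w * \<partial>\<^sub>v x w + (q w * \<partial>\<^sub>u (\<partial>\<^sub>v y) w + \<partial>\<^sub>u q w * \<partial>\<^sub>v y w)"
    using S U assms(2) by (simp add: partial_cong(1)[OF U assms(2) z(2)] partial_add[of U]
        partial_mult[of U] smooth_on_mult smooth_on_partial)
  ultimately show ?thesis
    using partials_commute[OF U S(1) assms(2)] partials_commute[OF U S(2) assms(2)]
      partials_commute[OF U S(3) assms(2)] by (simp add: jacobian_det_def algebra_simps)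
qed

text \<open>The derivatives of a function of the parameters with respect to the top view coordinates \<open>x\<close> and
  \<open>y\<close> are quotients of Jacobian determinants.\<close>

lemma top_view_local_inverse_derivative:
  assumes W: "smooth_on W h" "g k \<in> W" "jacobian_det x y (g k) \<noteq> 0"
    and g: "(g has_derivative (\<lambda>d.
      ((fst d * \<partial>\<^sub>v y (g k) - snd d * \<partial>\<^sub>v x (g k)) / jacobian_det x y (g k),
       (snd d * \<partial>\<^sub>u x (g k) - fst d * \<partial>\<^sub>u y (g k)) / jacobian_det x y (g k)))) (at k)"
  shows "((\<lambda>k. h (g k)) has_derivative (\<lambda>d. fst d * (jacobian_det h y (g k) / jacobian_det x y (g k))
     + snd d * (jacobian_det x h (g k) / jacobian_det x y (g k)))) (at k)"
  by (rule has_derivative_eq_rhs[OF has_derivative_compose[OF g has_derivative_partials[OF W(1,2)]]])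
    (use W(3) in \<open>auto simp: jacobian_det_def[of h] jacobian_det_def[of x h] field_simps\<close>)

text \<open>The Hessian of the height function is the derivative of its gradient \<open>(p, q)\<close> with respect to
  \<open>(x, y)\<close>, so the curvature, being its determinant, is the Jacobian of \<open>(p, q)\<close> divided by that
  of \<open>(x, y)\<close>. The proof also has to show that the value does not depend on the local graph
  representation: any two height functions agree near the top view of the point.\<close>

lemma iso_curvature_contact_chart:
  assumes chart: "contact_chart U x y z p q" and "w0 \<in> U"
  shows "iso_curvature (\<lambda>w. (x w, y w, z w)) w0 = jacobian_det p q w0 / jacobian_det x y w0"
proof -
  let ?X = "\<lambda>w. (x w, y w, z w)" and ?J = "jacobian_det x y"
  have U: "open U" and S: "smooth_on U x" "smooth_on U y" "smooth_on U z" "smooth_on U p" "smooth_on U q"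
    and J0: "?J w0 \<noteq> 0"
    and z: "\<And>w. w \<in> U \<Longrightarrow> \<partial>\<^sub>u z w = p w * \<partial>\<^sub>u x w + q w * \<partial>\<^sub>u y w"
      "\<And>w. w \<in> U \<Longrightarrow> \<partial>\<^sub>v z w = p w * \<partial>\<^sub>v x w + q w * \<partial>\<^sub>v y w"
    using assms by (auto simp: contact_chart_def)
  obtain W N g where W: "open W" "W \<subseteq> U" "w0 \<in> W" "open N"
    and hom: "homeomorphism W N (\<lambda>w. (x w, y w)) g"
    and J: "\<And>w. w \<in> W \<Longrightarrow> ?J w \<noteq> 0"
    and g: "\<And>k. k \<in> N \<Longrightarrow> (g has_derivative (\<lambda>d.
      ((fst d * \<partial>\<^sub>v y (g k) - snd d * \<partial>\<^sub>v x (g k)) / ?J (g k),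
       (snd d * \<partial>\<^sub>u x (g k) - fst d * \<partial>\<^sub>u y (g k)) / ?J (g k)))) (at k)"
    using local_inverse[OF U S(1,2) \<open>w0 \<in> U\<close> J0] by blast
  have gW: "g k \<in> W" and fg: "x (g k) = fst k" "y (g k) = snd k" if "k \<in> N" for k
    using hom that by (auto simp: homeomorphism_def)
  have gf: "(x w, y w) \<in> N" "g (x w, y w) = w" if "w \<in> W" for w
    using hom that by (auto simp: homeomorphism_def)
  define k0 where "k0 = (x w0, y w0)"
  have k0: "k0 \<in> N" "g k0 = w0" using gf W(3) by (simp_all add: k0_def)
  have SW: "smooth_on W x" "smooth_on W y" "smooth_on W z" "smooth_on W p" "smooth_on W q"
    using S W by (auto intro: smooth_on_subset)
  have comp: "((\<lambda>k. h (g k)) has_derivative (\<lambda>d. fst d * (jacobian_det h y (g k) / ?J (g k))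
     + snd d * (jacobian_det x h (g k) / ?J (g k)))) (at k)" if "k \<in> N" "smooth_on W h" for h k
    using top_view_local_inverse_derivative[OF that(2) gW J g] that gW by blast
  \<comment> \<open>A directional derivative of \<open>h \<circ> g\<close> is again of the form \<open>h' \<circ> g\<close> with \<open>h'\<close> smooth, so the
    local inverse never has to be differentiated more than once.\<close>
  have smooth_comp: "smooth_on N (\<lambda>k. h (g k))" if "smooth_on W h" for h :: "real \<times> real \<Rightarrow> real"
  proof (rule smooth_on_coinduct[where P = "\<lambda>\<psi>. \<exists>h :: real \<times> real \<Rightarrow> real. smooth_on W h \<and> \<psi> = (\<lambda>k. h (g k))", OF W(4)])
    fix \<psi> :: "real \<times> real \<Rightarrow> real" assume "\<exists>h. smooth_on W h \<and> \<psi> = (\<lambda>k. h (g k))"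
    then obtain h where h: "smooth_on W h" "\<psi> = (\<lambda>k. h (g k))" by blast
    let ?D = "\<lambda>d w. fst d * (jacobian_det h y w / ?J w) + snd d * (jacobian_det x h w / ?J w)"
    have "smooth_on W (?D d)" for d
      using W(1) SW h J by (intro smooth_on_add smooth_on_mult smooth_on_const smooth_on_divide smooth_on_jacobian_det)
    then show "\<exists>D. (\<forall>k\<in>N. (\<psi> has_derivative D k) (at k)) \<and>
        (\<forall>d. \<exists>h. smooth_on W h \<and> (\<lambda>k. D k d) = (\<lambda>k. h (g k)))"
      using comp[OF _ h(1)] unfolding h(2)
      by (intro exI[of _ "\<lambda>k d. ?D d (g k)"] conjI ballI allI) blast+
  qed (use that in blast)
  \<comment> \<open>The height function over the top view; its gradient at \<open>k\<close> is \<open>(p, q)\<close> at \<open>g k\<close>.\<close>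
  define \<phi> where "\<phi> = (\<lambda>k. z (g k))"
  have \<phi>1: "\<partial>\<^sub>u \<phi> k = p (g k)" "\<partial>\<^sub>v \<phi> k = q (g k)" if k: "k \<in> N" for k
  proof -
    have "g k \<in> U" using gW[OF k] W(2) by blast
    note zz = z[OF this]
    have "jacobian_det z y (g k) = p (g k) * ?J (g k)" "jacobian_det x z (g k) = q (g k) * ?J (g k)"
      unfolding jacobian_det_def[of z] jacobian_det_def[of x] zz by algebra+
    then show "\<partial>\<^sub>u \<phi> k = p (g k)" "\<partial>\<^sub>v \<phi> k = q (g k)"
      using partial_eqI[OF comp[OF k SW(3)]] J[OF gW[OF k]] by (simp_all add: \<phi>_def)
  qed
  define K where "K \<psi> = \<partial>\<^sub>u (\<partial>\<^sub>u \<psi>) k0 * \<partial>\<^sub>v (\<partial>\<^sub>v \<psi>) k0 - (\<partial>\<^sub>v (\<partial>\<^sub>u \<psi>) k0)\<^sup>2"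
    for \<psi> :: "real \<times> real \<Rightarrow> real"
  have "K \<phi> = (jacobian_det p y w0 / ?J w0) * (jacobian_det x q w0 / ?J w0) - (jacobian_det x p w0 / ?J w0)\<^sup>2"
    unfolding K_def
    using partial_cong[OF W(4) k0(1) \<phi>1(1)] partial_cong[OF W(4) k0(1) \<phi>1(2)]
      partial_eqI[OF comp[OF k0(1) SW(4)]] partial_eqI[OF comp[OF k0(1) SW(5)]]
    by (simp add: k0(2))
  also have "\<dots> = (jacobian_det p y w0 * jacobian_det x q w0 - jacobian_det x p w0 * jacobian_det q y w0) / (?J w0)\<^sup>2"
    using J0 contact_chart_symmetry[OF assms] by (simp add: power2_eq_square diff_divide_distrib)
  \<comment> \<open>The Pluecker relation between the six minors of a \<open>2 \<times> 4\<close> matrix.\<close>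
  also have "jacobian_det p y w0 * jacobian_det x q w0 - jacobian_det x p w0 * jacobian_det q y w0 = jacobian_det p q w0 * ?J w0"
    unfolding jacobian_det_def by algebra
  finally have K: "K \<phi> = jacobian_det p q w0 / ?J w0" using J0 by (simp add: power2_eq_square)
  have unique: "k = K \<phi>" if has: "has_iso_curvature ?X w0 k" for k
  proof -
    obtain W' N' \<psi> where W': "open W'" "w0 \<in> W'" "?X ` W' = (\<lambda>(a, b). (a, b, \<psi> (a, b))) ` N'"
      and k: "k = K \<psi>"
      using has unfolding has_iso_curvature_def Let_def K_def k0_def top_view.simps by blast
    have graph: "z w = \<psi> (x w, y w)" if "w \<in> W'" for w
    proof -
      have "?X w \<in> (\<lambda>(a, b). (a, b, \<psi> (a, b))) ` N'" using W'(3) that by blast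
      then show ?thesis by auto
    qed
    define M where "M = N \<inter> g -` W'"
    have "continuous_on N g" using hom by (simp add: homeomorphism_def)
    then have "open M" unfolding M_def
      using continuous_on_open_vimage[OF W(4)] W'(1) by (metis inf_commute)
    have "k0 \<in> M" using k0 W'(2) by (simp add: M_def)
    have eq: "\<psi> m = \<phi> m" if "m \<in> M" for m
      using that graph[of "g m"] fg[of m] by (auto simp: M_def \<phi>_def)
    have eq1: "\<partial>\<^sub>u \<psi> m = \<partial>\<^sub>u \<phi> m" "\<partial>\<^sub>v \<psi> m = \<partial>\<^sub>v \<phi> m" if "m \<in> M" for m
      using partial_cong[OF \<open>open M\<close> that eq] by auto
    show "k = K \<phi>" unfolding k K_def
      using partial_cong[OF \<open>open M\<close> \<open>k0 \<in> M\<close> eq1(1)] partial_cong[OF \<open>open M\<close> \<open>k0 \<in> M\<close> eq1(2)] by simp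
  qed
  have "?X ` W = (\<lambda>(a, b). (a, b, \<phi> (a, b))) ` N"
  proof
    show "?X ` W \<subseteq> (\<lambda>(a, b). (a, b, \<phi> (a, b))) ` N"
      using gf by (force simp: \<phi>_def)
    show "(\<lambda>(a, b). (a, b, \<phi> (a, b))) ` N \<subseteq> ?X ` W"
      using gW fg by (force simp: \<phi>_def)
  qed
  then have "has_iso_curvature ?X w0 (K \<phi>)"
    unfolding has_iso_curvature_def Let_def K_def
    using W smooth_comp[OF SW(3)] by (intro exI[of _ W] exI[of _ N] exI[of _ \<phi>]) (auto simp: \<phi>_def k0_def)
  then have "iso_curvature ?X w0 = K \<phi>"
    unfolding iso_curvature_def using unique by (rule the_equality)
  then show ?thesis by (simp add: K)
qed

lemma contact_chart_partials:
  assumes "contact_chart U x y z p q" "w \<in> U"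
  shows "\<partial>\<^sub>u (\<lambda>w. (x w, y w, z w)) w = (\<partial>\<^sub>u x w, \<partial>\<^sub>u y w, p w * \<partial>\<^sub>u x w + q w * \<partial>\<^sub>u y w)"
    and "\<partial>\<^sub>v (\<lambda>w. (x w, y w, z w)) w = (\<partial>\<^sub>v x w, \<partial>\<^sub>v y w, p w * \<partial>\<^sub>v x w + q w * \<partial>\<^sub>v y w)"
  using assms by (simp_all add: contact_chart_def partial_Pair[of U] smooth_on_Pair)

lemma contact_chart_top_partials:
  assumes "contact_chart U x y z p q" "w \<in> U"
  shows "top_u (\<lambda>w. (x w, y w, z w)) w = (\<partial>\<^sub>u x w, \<partial>\<^sub>u y w)"
    and "top_v (\<lambda>w. (x w, y w, z w)) w = (\<partial>\<^sub>v x w, \<partial>\<^sub>v y w)"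
  using assms by (simp_all add: top_u_def top_v_def comp_def contact_chart_def partial_Pair[of U])

lemma contact_chart_tangent_plane:
  assumes "contact_chart U x y z p q" "w \<in> U"
  shows "tangent_plane (\<lambda>w. (x w, y w, z w)) w = contact_plane (x w, y w, z w, p w, q w)"
proof
  show "tangent_plane (\<lambda>w. (x w, y w, z w)) w \<subseteq> contact_plane (x w, y w, z w, p w, q w)"
    by (auto simp: tangent_plane_def contact_chart_partials[OF assms] inner_prod_def algebra_simps)
  have J: "\<partial>\<^sub>u x w * \<partial>\<^sub>v y w - \<partial>\<^sub>v x w * \<partial>\<^sub>u y w \<noteq> 0"
    using assms by (simp add: contact_chart_def jacobian_det_def)
  \<comment> \<open>Cramer's rule solves for the two top view coordinates; the height then fits automatically.\<close>
  show "contact_plane (x w, y w, z w, p w, q w) \<subseteq> tangent_plane (\<lambda>w. (x w, y w, z w)) w"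
  proof
    fix P assume P: "P \<in> contact_plane (x w, y w, z w, p w, q w)"
    obtain s t where st: "fst P - x w = s" "fst (snd P) - y w = t" by blast
    have z: "snd (snd P) - z w = p w * s + q w * t"
      using P st by (cases P) (auto simp: inner_prod_def algebra_simps)
    obtain a b where ab: "a * \<partial>\<^sub>u x w + b * \<partial>\<^sub>v x w = s" "a * \<partial>\<^sub>u y w + b * \<partial>\<^sub>v y w = t"
      using cramer(1,2)[OF J] by blast
    have "P = (x w, y w, z w) + a *\<^sub>R \<partial>\<^sub>u (\<lambda>w. (x w, y w, z w)) w + b *\<^sub>R \<partial>\<^sub>v (\<lambda>w. (x w, y w, z w)) w"
      using st z unfolding ab[symmetric] contact_chart_partials[OF assms]
      by (cases P) (simp add: algebra_simps)
    then show "P \<in> tangent_plane (\<lambda>w. (x w, y w, z w)) w"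
      unfolding tangent_plane_def by blast
  qed
qed

lemma contact_chart_regular:
  assumes "contact_chart U x y z p q"
  shows "regular_surface U (\<lambda>w. (x w, y w, z w))"
  unfolding regular_surface_def
proof (intro conjI ballI)
  show "open U" "smooth_on U (\<lambda>w. (x w, y w, z w))"
    using assms by (auto simp: contact_chart_def intro!: smooth_on_Pair)
  fix w assume w: "w \<in> U"
  let ?u = "\<partial>\<^sub>u (\<lambda>w. (x w, y w, z w)) w" and ?v = "\<partial>\<^sub>v (\<lambda>w. (x w, y w, z w)) w"
  have J: "\<partial>\<^sub>u x w * \<partial>\<^sub>v y w - \<partial>\<^sub>v x w * \<partial>\<^sub>u y w \<noteq> 0"
    using assms w by (simp add: contact_chart_def jacobian_det_def)
  have "?v \<noteq> 0"
    using J by (auto simp: contact_chart_partials[OF assms w] zero_prod_def)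
  moreover have "?u \<notin> span {?v}"
    using J by (auto simp: span_singleton contact_chart_partials[OF assms w])
  ultimately have "independent {?u, ?v}" "?u \<noteq> ?v"
    by (auto simp: independent_insert span_base)
  then show "dim {?u, ?v} = 2" by (simp add: dim_eq_card_independent)
qed

lemma contact_chart_representation:
  assumes "contact_chart U x y z p q"
  shows "contact_representation U (\<lambda>w. (x w, y w, z w)) (\<lambda>w. (x w, y w, z w, p w, q w))"
  unfolding contact_representation_def
  using contact_chart_regular[OF assms] contact_chart_tangent_plane[OF assms] by simp

lemma contact_chart_admissible:
  assumes "contact_chart U x y z p q"
  shows "admissible_surface U (\<lambda>w. (x w, y w, z w))"
  unfolding admissible_surface_def
proof (intro conjI ballI notI contact_chart_regular[OF assms])
  fix w assume w: "w \<in> U" and "isotropic (tangent_plane (\<lambda>w. (x w, y w, z w)) w)"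
  then have iso: "isotropic (contact_plane (x w, y w, z w, p w, q w))"
    by (simp only: contact_chart_tangent_plane[OF assms])
  have "(x w, y w, z w) \<in> contact_plane (x w, y w, z w, p w, q w)"
    by simp
  with iso have "(x w, y w, z w) + (0, 0, 1) \<in> contact_plane (x w, y w, z w, p w, q w)"
    unfolding isotropic_def by blast
  then show False by (simp add: inner_prod_def)
qed

section \<open>Pairs of surfaces with rotated top views\<close>

text \<open>If the top view of \<open>Y\<close> is that of \<open>X\<close> turned by a right angle (the sign \<open>e\<close> gives the sense), then
  the top view of \<open>X + t Y\<close> arises from that of \<open>X\<close> by a similarity with matrix \<open>1 + t e J\<close> and
  squared scaling factor \<open>1 + t\<^sup>2\<close>. With respect to the undeformed top view, \<open>X + t Y\<close> has gradient
  \<open>(p + t e s, q - t e r)\<close>; the inverse transpose of the similarity turns it into the gradient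
  given here. So the Jacobian of the gradient is that of \<open>(p + t e s, q - t e r)\<close> divided by
  \<open>1 + t\<^sup>2\<close>, a quadratic polynomial in \<open>t\<close> up to this factor.\<close>

lemma contact_chart_deformation:
  fixes t e :: real
  defines "xt \<equiv> \<lambda>x y w. x w - t * e * y w" and "yt \<equiv> \<lambda>x y w. y w + t * e * x w"
    and "pt \<equiv> \<lambda>p q r s w. (p w + t\<^sup>2 * r w + t * e * (s w - q w)) * (1 / (1 + t\<^sup>2))"
    and "qt \<equiv> \<lambda>p q r s w. (q w + t\<^sup>2 * s w + t * e * (p w - r w)) * (1 / (1 + t\<^sup>2))"
  assumes X: "contact_chart U x y z p q"
    and Y: "contact_chart U (\<lambda>w. - (e * y w)) (\<lambda>w. e * x w) z' r s" and e: "e * e = 1"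
  shows "contact_chart U (xt x y) (yt x y) (\<lambda>w. z w + t * z' w) (pt p q r s) (qt p q r s)"
    and "w \<in> U \<Longrightarrow> jacobian_det (xt x y) (yt x y) w = (1 + t\<^sup>2) * jacobian_det x y w"
    and "w \<in> U \<Longrightarrow> jacobian_det (pt p q r s) (qt p q r s) w = (jacobian_det p q w
        - t * e * (jacobian_det p r w + jacobian_det q s w) + t\<^sup>2 * jacobian_det r s w) / (1 + t\<^sup>2)"
proof -
  let ?x = "\<lambda>w. x w - t * e * y w" and ?y = "\<lambda>w. y w + t * e * x w"
    and ?z = "\<lambda>w. z w + t * z' w"
    and ?a = "\<lambda>w. (p w + t\<^sup>2 * r w + t * e * (s w - q w)) * (1 / (1 + t\<^sup>2))"
    and ?b = "\<lambda>w. (q w + t\<^sup>2 * s w + t * e * (p w - r w)) * (1 / (1 + t\<^sup>2))"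
  have U: "open U" and S: "smooth_on U x" "smooth_on U y" "smooth_on U z" "smooth_on U p" "smooth_on U q"
    and z: "\<And>w. w \<in> U \<Longrightarrow> \<partial>\<^sub>u z w = p w * \<partial>\<^sub>u x w + q w * \<partial>\<^sub>u y w"
      "\<And>w. w \<in> U \<Longrightarrow> \<partial>\<^sub>v z w = p w * \<partial>\<^sub>v x w + q w * \<partial>\<^sub>v y w"
      "\<And>w. w \<in> U \<Longrightarrow> jacobian_det x y w \<noteq> 0"
    using X by (auto simp: contact_chart_def)
  have S': "smooth_on U z'" "smooth_on U r" "smooth_on U s"
    and z': "\<And>w. w \<in> U \<Longrightarrow> \<partial>\<^sub>u z' w = r w * (- (e * \<partial>\<^sub>u y w)) + s w * (e * \<partial>\<^sub>u x w)"
      "\<And>w. w \<in> U \<Longrightarrow> \<partial>\<^sub>v z' w = r w * (- (e * \<partial>\<^sub>v y w)) + s w * (e * \<partial>\<^sub>v x w)"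
    using Y S by (auto simp: contact_chart_def partial_uminus[of U] partial_cmult[of U] smooth_on_mult smooth_on_const)
  have t: "1 + t\<^sup>2 \<noteq> 0" by (metis add_pos_nonneg less_irrefl zero_le_power2 zero_less_one)
  note smooth = S S' U smooth_on_const smooth_on_add smooth_on_mult smooth_on_diff
  have xy: "\<partial>\<^sub>u ?x w = \<partial>\<^sub>u x w - t * e * \<partial>\<^sub>u y w" "\<partial>\<^sub>v ?x w = \<partial>\<^sub>v x w - t * e * \<partial>\<^sub>v y w"
    "\<partial>\<^sub>u ?y w = \<partial>\<^sub>u y w + t * e * \<partial>\<^sub>u x w" "\<partial>\<^sub>v ?y w = \<partial>\<^sub>v y w + t * e * \<partial>\<^sub>v x w"
    "\<partial>\<^sub>u ?z w = \<partial>\<^sub>u z w + t * \<partial>\<^sub>u z' w" "\<partial>\<^sub>v ?z w = \<partial>\<^sub>v z w + t * \<partial>\<^sub>v z' w" if "w \<in> U" for w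
    using that by (simp_all add: partial_add[of U] partial_diff[of U] partial_mult[of U] smooth)
  have J: "jacobian_det ?x ?y w = (1 + t\<^sup>2) * jacobian_det x y w" if "w \<in> U" for w
    unfolding jacobian_det_def xy[OF that] using e by algebra
  then show "w \<in> U \<Longrightarrow> jacobian_det (xt x y) (yt x y) w = (1 + t\<^sup>2) * jacobian_det x y w"
    unfolding xt_def yt_def .
  show "contact_chart U (xt x y) (yt x y) ?z (pt p q r s) (qt p q r s)"
    unfolding contact_chart_def xt_def yt_def pt_def qt_def
  proof (intro conjI ballI)
    show "open U" "smooth_on U ?x" "smooth_on U ?y" "smooth_on U ?z" "smooth_on U ?a" "smooth_on U ?b"
      by (simp_all only: smooth)
    fix w assume w: "w \<in> U"
    show "jacobian_det ?x ?y w \<noteq> 0" unfolding J[OF w] using t z(3)[OF w] by simp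
    have k: "1 / (1 + t\<^sup>2) * (1 + t\<^sup>2) = 1" using t by simp
    obtain k where k: "k = 1 / (1 + t\<^sup>2)" "k * (1 + t\<^sup>2) = 1" using k by blast
    show "\<partial>\<^sub>u ?z w = ?a w * \<partial>\<^sub>u ?x w + ?b w * \<partial>\<^sub>u ?y w" "\<partial>\<^sub>v ?z w = ?a w * \<partial>\<^sub>v ?x w + ?b w * \<partial>\<^sub>v ?y w"
      unfolding xy[OF w] z[OF w] z'[OF w] k(1)[symmetric] using e k(2) by algebra+
  qed
  show "jacobian_det (pt p q r s) (qt p q r s) w = (jacobian_det p q w
        - t * e * (jacobian_det p r w + jacobian_det q s w) + t\<^sup>2 * jacobian_det r s w) / (1 + t\<^sup>2)"
    if w: "w \<in> U"
  proof -
    define k where "k = 1 / (1 + t\<^sup>2)"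
    have k: "k * (1 + t\<^sup>2) = 1" using t by (simp add: k_def)
    have ab: "\<partial>\<^sub>u ?a w = (\<partial>\<^sub>u p w + t\<^sup>2 * \<partial>\<^sub>u r w + t * e * (\<partial>\<^sub>u s w - \<partial>\<^sub>u q w)) * k"
      "\<partial>\<^sub>v ?a w = (\<partial>\<^sub>v p w + t\<^sup>2 * \<partial>\<^sub>v r w + t * e * (\<partial>\<^sub>v s w - \<partial>\<^sub>v q w)) * k"
      "\<partial>\<^sub>u ?b w = (\<partial>\<^sub>u q w + t\<^sup>2 * \<partial>\<^sub>u s w + t * e * (\<partial>\<^sub>u p w - \<partial>\<^sub>u r w)) * k"
      "\<partial>\<^sub>v ?b w = (\<partial>\<^sub>v q w + t\<^sup>2 * \<partial>\<^sub>v s w + t * e * (\<partial>\<^sub>v p w - \<partial>\<^sub>v r w)) * k"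
      unfolding k_def[symmetric] using w by (simp_all add: partial_add[of U] partial_mult[of U] partial_diff[of U] smooth)
    have "jacobian_det ?a ?b w = (jacobian_det p q w
        - t * e * (jacobian_det p r w + jacobian_det q s w) + t\<^sup>2 * jacobian_det r s w) * k"
      unfolding jacobian_det_def ab using e k by algebra
    then show ?thesis unfolding pt_def qt_def by (simp add: k_def)
  qed
qed

text \<open>The metric of the top view is multiplied by \<open>1 + t\<^sup>2\<close>, so it is always stationary at \<open>t = 0\<close>. The
  curvature of \<open>X + t Y\<close> is a quadratic polynomial in \<open>t\<close> divided by \<open>(1 + t\<^sup>2)\<^sup>2\<close> times the Jacobian of
  \<open>(x, y)\<close>, so only the linear coefficient of that polynomial decides whether \<open>Y\<close> is a velocity
  diagram. That coefficient is \<open>- e\<close> times the sum in the criterion.\<close>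

lemma velocity_diagram_iff:
  assumes X: "contact_chart U x y z p q"
    and Y: "contact_chart U (\<lambda>w. - (e * y w)) (\<lambda>w. e * x w) z' r s" and e: "e * e = 1"
  shows "velocity_diagram U (\<lambda>w. (x w, y w, z w)) (\<lambda>w. (- (e * y w), e * x w, z' w)) \<longleftrightarrow>
    (\<forall>w\<in>U. jacobian_det p r w + jacobian_det q s w = 0)"
proof -
  let ?X = "\<lambda>w. (x w, y w, z w)" and ?Y = "\<lambda>w. (- (e * y w), e * x w, z' w)"
  let ?E = "\<lambda>w. jacobian_det p r w + jacobian_det q s w"
  have def: "deformation ?X ?Y t
      = (\<lambda>w. (x w - t * e * y w, y w + t * e * x w, z w + t * z' w))" for t
    by (simp add: deformation_def fun_eq_iff)
  note chart = contact_chart_deformation[OF X Y e]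
  have S: "smooth_on U x" "smooth_on U y" "open U" using X by (simp_all add: contact_chart_def)
  have xy: "\<partial>\<^sub>u (\<lambda>w. x w - t * e * y w) w = \<partial>\<^sub>u x w - t * e * \<partial>\<^sub>u y w"
    "\<partial>\<^sub>v (\<lambda>w. x w - t * e * y w) w = \<partial>\<^sub>v x w - t * e * \<partial>\<^sub>v y w"
    "\<partial>\<^sub>u (\<lambda>w. y w + t * e * x w) w = \<partial>\<^sub>u y w + t * e * \<partial>\<^sub>u x w"
    "\<partial>\<^sub>v (\<lambda>w. y w + t * e * x w) w = \<partial>\<^sub>v y w + t * e * \<partial>\<^sub>v x w" if "w \<in> U" for w t
    using that S
    by (simp_all add: partial_add[of U] partial_diff[of U] partial_mult[of U] smooth_on_const smooth_on_mult)
  have metric: "((\<lambda>t. (a - t * e * b) * (c - t * e * d) + (b + t * e * a) * (d + t * e * c))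
      has_real_derivative 0) (at 0)" for a b c d
  proof -
    have "(a - t * e * b) * (c - t * e * d) + (b + t * e * a) * (d + t * e * c)
        = (1 + t\<^sup>2) * (a * c + b * d)" for t
      using e by algebra
    then show ?thesis by (auto intro!: derivative_eq_intros)
  qed
  have curv: "((\<lambda>t. iso_curvature (deformation ?X ?Y t) w) has_real_derivative
      - e * ?E w / jacobian_det x y w) (at 0)" if w: "w \<in> U" for w
  proof -
    have "iso_curvature (deformation ?X ?Y t) w = (jacobian_det p q w - t * e * ?E w
        + t\<^sup>2 * jacobian_det r s w) / ((1 + t\<^sup>2)\<^sup>2 * jacobian_det x y w)" for t
      unfolding def iso_curvature_contact_chart[OF chart(1) w] chart(2,3)[OF w]
      by (simp add: power2_eq_square mult.assoc)
    moreover have "jacobian_det x y w \<noteq> 0" using X w by (simp add: contact_chart_def)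
    ultimately show ?thesis
      by (auto intro!: derivative_eq_intros simp: power2_eq_square)
  qed
  have "((\<lambda>t. iso_curvature (deformation ?X ?Y t) w) has_real_derivative 0) (at 0) \<longleftrightarrow> ?E w = 0"
    if w: "w \<in> U" for w
  proof -
    have "jacobian_det x y w \<noteq> 0" "e \<noteq> 0" using X w e by (auto simp: contact_chart_def)
    then have "- e * ?E w / jacobian_det x y w = 0 \<longleftrightarrow> ?E w = 0" by simp
    moreover have "((\<lambda>t. iso_curvature (deformation ?X ?Y t) w) has_real_derivative 0) (at 0) \<longleftrightarrow>
        - e * ?E w / jacobian_det x y w = 0"
      using DERIV_unique[OF curv[OF w], of 0] curv[OF w] by (intro iffI) (simp_all only: simp_thms)
    ultimately show ?thesis by simp
  qed
  moreover have "smooth_on U ?Y"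
    using contact_chart_regular[OF Y] by (simp add: regular_surface_def)
  moreover have "admissible_surface U ?X" by (rule contact_chart_admissible[OF X])
  moreover have "((\<lambda>t. top_u (deformation ?X ?Y t) w \<bullet> top_u (deformation ?X ?Y t) w) has_real_derivative 0) (at 0)"
    "((\<lambda>t. top_u (deformation ?X ?Y t) w \<bullet> top_v (deformation ?X ?Y t) w) has_real_derivative 0) (at 0)"
    "((\<lambda>t. top_v (deformation ?X ?Y t) w \<bullet> top_v (deformation ?X ?Y t) w) has_real_derivative 0) (at 0)"
    if w: "w \<in> U" for w
    unfolding def contact_chart_top_partials[OF chart(1) w] xy[OF w] inner_Pair inner_real_def
    by (rule metric)+
  ultimately show ?thesis unfolding velocity_diagram_def by blast
qed

lemma I_orthogonal_rotated_top_view: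
  assumes X: "contact_chart U x y z p q"
    and Y: "contact_chart U (\<lambda>w. - (e * y w)) (\<lambda>w. e * x w) z' r s"
  shows "I_orthogonal U (\<lambda>w. (x w, y w, z w)) (\<lambda>w. (- (e * y w), e * x w, z' w))"
proof -
  have S: "smooth_on U x" "smooth_on U y" "open U" using X by (simp_all add: contact_chart_def)
  show ?thesis
    unfolding I_orthogonal_def
  proof (intro conjI ballI contact_chart_regular[OF X] contact_chart_regular[OF Y])
    fix w assume w: "w \<in> U"
    show "top_u (\<lambda>w. (x w, y w, z w)) w \<bullet> top_u (\<lambda>w. (- (e * y w), e * x w, z' w)) w = 0"
      "top_v (\<lambda>w. (x w, y w, z w)) w \<bullet> top_v (\<lambda>w. (- (e * y w), e * x w, z' w)) w = 0"
      "top_u (\<lambda>w. (x w, y w, z w)) w \<bullet> top_v (\<lambda>w. (- (e * y w), e * x w, z' w)) w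
        + top_v (\<lambda>w. (x w, y w, z w)) w \<bullet> top_u (\<lambda>w. (- (e * y w), e * x w, z' w)) w = 0"
      unfolding contact_chart_top_partials[OF X w] contact_chart_top_partials[OF Y w]
        partial_uminus[OF smooth_on_mult[OF S(3) smooth_on_const[OF S(3)] S(2)] w]
        partial_cmult[OF S(1) w] partial_cmult[OF S(2) w] inner_Pair inner_real_def by algebra+
  qed
qed

section \<open>The four surfaces\<close>

lemma contact_chart_graph:
  assumes "open U" "smooth_on U f"
  shows "contact_chart U fst snd f (\<partial>\<^sub>u f) (\<partial>\<^sub>v f)"
  using assms smooth_on_bounded_linear[OF assms(1) bounded_linear_fst]
    smooth_on_bounded_linear[OF assms(1) bounded_linear_snd]
  by (simp add: contact_chart_def jacobian_det_def smooth_on_partial)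

lemma contact_chart_rotation_field:
  assumes "open U" "smooth_on U n"
  shows "contact_chart U (\<lambda>w. - snd w) fst n (\<lambda>w. - \<partial>\<^sub>v n w) (\<partial>\<^sub>u n)"
  using assms smooth_on_bounded_linear[OF assms(1) bounded_linear_fst]
    smooth_on_bounded_linear[OF assms(1) bounded_linear_snd]
  by (simp add: contact_chart_def jacobian_det_def smooth_on_partial smooth_on_uminus
      partial_uminus[of U])

lemma contact_chart_translation_diagram:
  assumes "open U" "smooth_on U n"
    and "\<And>w. w \<in> U \<Longrightarrow> \<partial>\<^sub>u (\<partial>\<^sub>u n) w * \<partial>\<^sub>v (\<partial>\<^sub>v n) w - (\<partial>\<^sub>v (\<partial>\<^sub>u n) w)\<^sup>2 \<noteq> 0"
  shows "contact_chart U (\<lambda>w. - \<partial>\<^sub>v n w) (\<partial>\<^sub>u n)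
    (\<lambda>w. - n w + \<partial>\<^sub>u n w * fst w + \<partial>\<^sub>v n w * snd w) (\<lambda>w. - snd w) fst"
proof -
  note S = smooth_on_bounded_linear[OF assms(1) bounded_linear_fst]
    smooth_on_bounded_linear[OF assms(1) bounded_linear_snd] smooth_on_partial[OF assms(1)]
    smooth_on_uminus smooth_on_add smooth_on_diff smooth_on_mult assms(1,2)
  note commute = partials_commute[OF assms(1,2)]
  show ?thesis
    unfolding contact_chart_def
  proof (intro conjI ballI)
    show "open U" "smooth_on U (\<lambda>w. - \<partial>\<^sub>v n w)" "smooth_on U (\<partial>\<^sub>u n)"
      "smooth_on U (\<lambda>w. - n w + \<partial>\<^sub>u n w * fst w + \<partial>\<^sub>v n w * snd w)"
      "smooth_on U (\<lambda>w. - snd w)" "smooth_on U fst"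
      by (simp_all add: S)
    fix w assume w: "w \<in> U"
    show "jacobian_det (\<lambda>w. - \<partial>\<^sub>v n w) (\<partial>\<^sub>u n) w \<noteq> 0"
      using assms(3)[OF w] w
      by (simp add: jacobian_det_def partial_uminus[of U] S commute power2_eq_square algebra_simps)
    show "\<partial>\<^sub>u (\<lambda>w. - n w + \<partial>\<^sub>u n w * fst w + \<partial>\<^sub>v n w * snd w) w
        = - snd w * \<partial>\<^sub>u (\<lambda>w. - \<partial>\<^sub>v n w) w + fst w * \<partial>\<^sub>u (\<partial>\<^sub>u n) w"
      "\<partial>\<^sub>v (\<lambda>w. - n w + \<partial>\<^sub>u n w * fst w + \<partial>\<^sub>v n w * snd w) w
        = - snd w * \<partial>\<^sub>v (\<lambda>w. - \<partial>\<^sub>v n w) w + fst w * \<partial>\<^sub>v (\<partial>\<^sub>u n) w"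
      using w by (simp_all add: partial_uminus[of U] partial_add[of U] partial_diff[of U] partial_mult[of U] S)
  qed
qed

text \<open>The prescribed derivatives of \<open>c\<close> are exactly what \<open>dc = f\<^sub>v d(- n\<^sub>u) - f\<^sub>u d(- n\<^sub>v)\<close> says, once
  the mixed derivatives of \<open>n\<close> are identified.\<close>

lemma contact_chart_rotation_diagram:
  assumes "open U" "smooth_on U f" "smooth_on U n"
    and "\<And>w. w \<in> U \<Longrightarrow> \<partial>\<^sub>u (\<partial>\<^sub>u n) w * \<partial>\<^sub>v (\<partial>\<^sub>v n) w - (\<partial>\<^sub>v (\<partial>\<^sub>u n) w)\<^sup>2 \<noteq> 0"
    and c_u: "\<And>u v. (u, v) \<in> U \<Longrightarrow>
      ((\<lambda>s. c (s, v)) has_real_derivative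
         (\<partial>\<^sub>u f (u, v) * \<partial>\<^sub>v (\<partial>\<^sub>u n) (u, v) - \<partial>\<^sub>v f (u, v) * \<partial>\<^sub>u (\<partial>\<^sub>u n) (u, v))) (at u)"
    and c_v: "\<And>u v. (u, v) \<in> U \<Longrightarrow>
      ((\<lambda>s. c (u, s)) has_real_derivative
         (\<partial>\<^sub>u f (u, v) * \<partial>\<^sub>v (\<partial>\<^sub>v n) (u, v) - \<partial>\<^sub>v f (u, v) * \<partial>\<^sub>v (\<partial>\<^sub>u n) (u, v))) (at v)"
  shows "contact_chart U (\<lambda>w. - \<partial>\<^sub>u n w) (\<lambda>w. - \<partial>\<^sub>v n w) c (\<partial>\<^sub>v f) (\<lambda>w. - \<partial>\<^sub>u f w)"
proof -
  have S: "smooth_on U (\<partial>\<^sub>u f)" "smooth_on U (\<partial>\<^sub>v f)" "smooth_on U (\<partial>\<^sub>u n)" "smooth_on U (\<partial>\<^sub>v n)"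
    "smooth_on U (\<partial>\<^sub>u (\<partial>\<^sub>u n))" "smooth_on U (\<partial>\<^sub>v (\<partial>\<^sub>u n))" "smooth_on U (\<partial>\<^sub>v (\<partial>\<^sub>v n))"
    using assms(1-3) by (simp_all add: smooth_on_partial)
  have "smooth_on U (\<lambda>w. \<partial>\<^sub>u f w * \<partial>\<^sub>v (\<partial>\<^sub>u n) w - \<partial>\<^sub>v f w * \<partial>\<^sub>u (\<partial>\<^sub>u n) w)"
    "smooth_on U (\<lambda>w. \<partial>\<^sub>u f w * \<partial>\<^sub>v (\<partial>\<^sub>v n) w - \<partial>\<^sub>v f w * \<partial>\<^sub>v (\<partial>\<^sub>u n) w)"
    by (intro smooth_on_diff smooth_on_mult S assms(1))+
  note c = smooth_on_if_partials_smooth[OF assms(1) this c_u c_v]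
  show ?thesis
    using assms(1,4)
    by (simp add: contact_chart_def jacobian_det_def S c smooth_on_uminus partial_uminus[of U]
        partials_commute[OF assms(1,3)] power2_eq_square algebra_simps)
qed

lemma contact_plane_parallel:
  "affine_parallel (contact_plane (a, b, k, p, q)) (contact_plane (a', b', k', p, q))"
proof -
  have "x \<in> contact_plane (a, b, k, p, q) \<longleftrightarrow>
      (a' - a, b' - b, k' - k) + x \<in> contact_plane (a', b', k', p, q)" for x
    by (cases x) (simp add: algebra_simps)
  then show ?thesis unfolding affine_parallel_expl by blast
qed

theorem theorem34:
  fixes U :: "(real \<times> real) set" and f n c :: "real \<times> real \<Rightarrow> real"
  assumes "open U" and "smooth_on U f" and "smooth_on U n"
    and "velocity_diagram U (graph_surface f) (rotation_field n)"
    and "\<And>p. p \<in> U \<Longrightarrow> \<partial>\<^sub>u (\<partial>\<^sub>u n) p * \<partial>\<^sub>v (\<partial>\<^sub>v n) p - (\<partial>\<^sub>v (\<partial>\<^sub>u n) p)\<^sup>2 \<noteq> 0"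
    and "\<And>u v. (u, v) \<in> U \<Longrightarrow>
      ((\<lambda>s. c (s, v)) has_real_derivative
         (\<partial>\<^sub>u f (u, v) * \<partial>\<^sub>v (\<partial>\<^sub>u n) (u, v) - \<partial>\<^sub>v f (u, v) * \<partial>\<^sub>u (\<partial>\<^sub>u n) (u, v))) (at u)"
    and "\<And>u v. (u, v) \<in> U \<Longrightarrow>
      ((\<lambda>s. c (u, s)) has_real_derivative
         (\<partial>\<^sub>u f (u, v) * \<partial>\<^sub>v (\<partial>\<^sub>v n) (u, v) - \<partial>\<^sub>v f (u, v) * \<partial>\<^sub>v (\<partial>\<^sub>u n) (u, v))) (at v)"
  shows "let F = graph_surface f; V = rotation_field n;
             C = rotation_diagram n c; Cbar = translation_diagram n
    in (\<forall>p\<in>U. \<partial>\<^sub>u (\<partial>\<^sub>u f) p * \<partial>\<^sub>v (\<partial>\<^sub>v n) p - 2 * \<partial>\<^sub>v (\<partial>\<^sub>u f) p * \<partial>\<^sub>v (\<partial>\<^sub>u n) p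
          + \<partial>\<^sub>v (\<partial>\<^sub>v f) p * \<partial>\<^sub>u (\<partial>\<^sub>u n) p = 0)
     \<and> contact_representation U F
         (\<lambda>(u, v). (u, v, f (u, v), \<partial>\<^sub>u f (u, v), \<partial>\<^sub>v f (u, v)))
     \<and> contact_representation U V
         (\<lambda>(u, v). (- v, u, n (u, v), - \<partial>\<^sub>v n (u, v), \<partial>\<^sub>u n (u, v)))
     \<and> contact_representation U C
         (\<lambda>(u, v). (- \<partial>\<^sub>u n (u, v), - \<partial>\<^sub>v n (u, v), c (u, v), \<partial>\<^sub>v f (u, v), - \<partial>\<^sub>u f (u, v)))
     \<and> contact_representation U Cbar
         (\<lambda>(u, v). (- \<partial>\<^sub>v n (u, v), \<partial>\<^sub>u n (u, v),
            - n (u, v) + \<partial>\<^sub>u n (u, v) * u + \<partial>\<^sub>v n (u, v) * v, - v, u))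
     \<and> I_orthogonal U F V \<and> I_orthogonal U C Cbar
     \<and> correspond_in_duality U V Cbar
     \<and> (\<forall>p\<in>U. affine_parallel (tangent_plane F p) (tangent_plane (rotate_J \<circ> C) p))
     \<and> velocity_diagram U C Cbar \<and> velocity_diagram U Cbar C"
proof -
  let ?F = "\<lambda>w. (fst w, snd w, f w)" and ?V = "\<lambda>w. (- snd w, fst w, n w)"
    and ?C = "\<lambda>w. (- \<partial>\<^sub>u n w, - \<partial>\<^sub>v n w, c w)"
    and ?B = "\<lambda>w. (- \<partial>\<^sub>v n w, \<partial>\<^sub>u n w, - n w + \<partial>\<^sub>u n w * fst w + \<partial>\<^sub>v n w * snd w)"
  have surfaces: "graph_surface f = ?F" "rotation_field n = ?V"
    "rotation_diagram n c = ?C" "translation_diagram n = ?B"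
    by (simp_all add: fun_eq_iff graph_surface_def rotation_field_def rotation_diagram_def
        translation_diagram_def)
  note F = contact_chart_graph[OF assms(1,2)]
  note V = contact_chart_rotation_field[OF assms(1,3)]
  note C = contact_chart_rotation_diagram[OF assms(1-3,5-7)]
  note B = contact_chart_translation_diagram[OF assms(1,3,5)]
  \<comment> \<open>\<open>J\<close> turns the gradient of \<open>C\<close> as well as its top view, and the turned gradient is that of \<open>F\<close>.\<close>
  have JC: "contact_chart U (\<partial>\<^sub>v n) (\<lambda>w. - \<partial>\<^sub>u n w) c (\<partial>\<^sub>u f) (\<partial>\<^sub>v f)"
    using C by (simp add: contact_chart_def jacobian_det_def smooth_on_partial[OF assms(1)] assms(1,2,3)
        partial_uminus[of U] algebra_simps)
  have mixed: "\<partial>\<^sub>u (\<partial>\<^sub>v f) w = \<partial>\<^sub>v (\<partial>\<^sub>u f) w" "\<partial>\<^sub>u (\<partial>\<^sub>v n) w = \<partial>\<^sub>v (\<partial>\<^sub>u n) w" if "w \<in> U" for w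
    using that by (auto intro: partials_commute assms(1-3))
  have S: "smooth_on U (\<partial>\<^sub>u f)" "smooth_on U (\<partial>\<^sub>v f)" "smooth_on U (\<partial>\<^sub>u n)" "smooth_on U (\<partial>\<^sub>v n)"
    "smooth_on U fst" "smooth_on U snd"
    using assms(1-3) by (simp_all add: smooth_on_partial smooth_on_bounded_linear bounded_linear_fst bounded_linear_snd)
  have flex: "\<forall>w\<in>U. \<partial>\<^sub>u (\<partial>\<^sub>u f) w * \<partial>\<^sub>v (\<partial>\<^sub>v n) w - 2 * \<partial>\<^sub>v (\<partial>\<^sub>u f) w * \<partial>\<^sub>v (\<partial>\<^sub>u n) w
      + \<partial>\<^sub>v (\<partial>\<^sub>v f) w * \<partial>\<^sub>u (\<partial>\<^sub>u n) w = 0"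
  proof
    fix w assume w: "w \<in> U"
    have "jacobian_det (\<partial>\<^sub>u f) (\<lambda>w. - \<partial>\<^sub>v n w) w + jacobian_det (\<partial>\<^sub>v f) (\<partial>\<^sub>u n) w = 0"
      using velocity_diagram_iff[OF F, of 1 n] V assms(4) w unfolding surfaces by simp
    then show "\<partial>\<^sub>u (\<partial>\<^sub>u f) w * \<partial>\<^sub>v (\<partial>\<^sub>v n) w - 2 * \<partial>\<^sub>v (\<partial>\<^sub>u f) w * \<partial>\<^sub>v (\<partial>\<^sub>u n) w
      + \<partial>\<^sub>v (\<partial>\<^sub>v f) w * \<partial>\<^sub>u (\<partial>\<^sub>u n) w = 0"
      using w by (simp add: jacobian_det_def mixed partial_uminus[of U] S algebra_simps)
  qed
  \<comment> \<open>The top view of \<open>V\<close> is that of \<open>F\<close> turned by \<open>J\<close>; that of the translation diagram is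
    the top view of \<open>C\<close> turned by \<open>- J\<close>, whence the signs \<open>1\<close> and \<open>-1\<close>.\<close>
  have orth: "I_orthogonal U ?F ?V" "I_orthogonal U ?C ?B"
    using I_orthogonal_rotated_top_view[OF F, of 1] V I_orthogonal_rotated_top_view[OF C, of "-1"] B
    by auto
  \<comment> \<open>The criterion reduces to \<open>f\<^sub>u\<^sub>v - f\<^sub>v\<^sub>u = 0\<close>, and to its negative when the roles of the
    surfaces are exchanged.\<close>
  have "velocity_diagram U ?C ?B"
    using velocity_diagram_iff[OF C, of "-1"] B
    by (simp add: jacobian_det_def mixed partial_uminus[of U] S)
  moreover have "velocity_diagram U ?B ?C"
    using velocity_diagram_iff[OF B, of 1] C
    by (simp add: jacobian_det_def mixed partial_uminus[of U] S)
  moreover have rep: "contact_representation U ?F (\<lambda>w. (fst w, snd w, f w, \<partial>\<^sub>u f w, \<partial>\<^sub>v f w))"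
    "contact_representation U ?V (\<lambda>w. (- snd w, fst w, n w, - \<partial>\<^sub>v n w, \<partial>\<^sub>u n w))"
    "contact_representation U ?C (\<lambda>w. (- \<partial>\<^sub>u n w, - \<partial>\<^sub>v n w, c w, \<partial>\<^sub>v f w, - \<partial>\<^sub>u f w))"
    "contact_representation U ?B (\<lambda>w. (- \<partial>\<^sub>v n w, \<partial>\<^sub>u n w,
        - n w + \<partial>\<^sub>u n w * fst w + \<partial>\<^sub>v n w * snd w, - snd w, fst w))"
    using contact_chart_representation[OF F] contact_chart_representation[OF V]
      contact_chart_representation[OF C] contact_chart_representation[OF B] by blast+
  moreover have "correspond_in_duality U ?V ?B"
    unfolding correspond_in_duality_def
    by (intro exI conjI, rule rep(2), rule rep(4)) simp
  moreover have "\<forall>w\<in>U. affine_parallel (tangent_plane ?F w) (tangent_plane (rotate_J \<circ> ?C) w)"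
  proof
    fix w assume w: "w \<in> U"
    have "rotate_J \<circ> ?C = (\<lambda>w. (\<partial>\<^sub>v n w, - \<partial>\<^sub>u n w, c w))" by (simp add: fun_eq_iff)
    then show "affine_parallel (tangent_plane ?F w) (tangent_plane (rotate_J \<circ> ?C) w)"
      using contact_chart_tangent_plane[OF F w] contact_chart_tangent_plane[OF JC w]
      by (simp only: contact_plane_parallel)
  qed
  ultimately show ?thesis
    using flex orth unfolding Let_def surfaces case_prod_unfold prod.collapse by blast
qed

end
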